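(* Let $U$ be a chain of ideals of height $\xi\in\{1,2,3,\ldots,\omega\}$, with $\mathscr J=\mathscr D$-classes $D_0<D_1<\cdots$ (indexed by $0\le q<\xi$) and ideals $I_r=D_0\cup\cdots\cup D_r$ ($0\le r<\xi$), and $I_\omega=U$ if $\xi=\omega$. For each $0\le q<\xi$ let $G_q$ be a group $\mathscr H$-class contained in $D_q$. Suppose there exists $0\le k<\xi$ such that: - every congruence on $I_k$ is liftable to $U$, - $\nabla\mathsf{gen}(I_k)$ holds, - $\mathsf{Sep}^\zeta(I_r)$ holds for all $k<r<\xi$. Then for any $r\ge k$ (i.e. $k\le r<\xi$, and also $r=\omega$ if $\xi=\omega$): (i) $\operatorname{Cong}_{\mathscr H}(I_r)=\{\Theta^{I_r}(\mathbf N):\mathbf N\text{ is an NZ-tuple in }I_r\}$; (ii) $$\begin{aligned}\operatorname{Cong}(I_r)=\ &\{\sigma\cup\theta:\ \sigma\in\operatorname{Cong}(I_k),\ \theta\in\operatorname{Cong}_{\mathscr H}(I_r),\ \theta{\restriction}_{I_k}\subseteq\sigma\}\\ &\cup\{R^{I_r}_{I_q,N}\cup\theta:\ k\le q<r,\ N\unlhd G_{q+1},\ \theta\in\operatorname{Cong}_{\mathscr H}(I_r),\ \mathbf N(\theta)_{q+1}\le N\}\cup\{\widetilde\nabla_{I_r}\}.\end{aligned}$$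
   Context: **Partial semigroups.** A partial semigroup is a 5-tuple $(S,\mathscr C,\mathbf d,\mathbf r,\cdot)$ with $\mathbf d,\mathbf r:S\to\mathscr C$ and $\cdot$ a partial binary operation on $S$ such that $xy$ is defined iff $\mathbf r(x)=\mathbf d(y)$, in which case $\mathbf d(xy)=\mathbf d(x)$ and $\mathbf r(xy)=\mathbf r(y)$, and $(xy)z=x(yz)$ whenever $xy$ and $yz$ are defined. $S^1$ is the category obtained by adjoining identities at objects where needed. Write $x\sim y$ if $\mathbf d(x)=\mathbf d(y)$ and $\mathbf r(x)=\mathbf r(y)$. An ideal is a non-empty $I\subseteq S$ containing all defined products $sx$, $xs$ ($x\in I$, $s\in S$). $x$ is regular if $x=xax$ for some $a\in S$. Green's relations: $x\mathrel{\mathscr R}y\Leftrightarrow xS^1=yS^1$, $x\mathrel{\mathscr L}y\Leftrightarrow S^1x=S^1y$, $x\mathrel{\mathscr J}y\Leftrightarrow S^1xS^1=S^1yS^1$, $\mathscr H=\mathscr R\cap\mathscr L$, $\mathscr D=\mathscr R\vee\mathscr L$; $\mathscr J$-classes are ordered by $J_x\le J_y\Leftrightarrow x\in S^1yS^1$; $H^S_x$ is the $\mathscr H$-class of $x$. A $\mathscr J$-class $J$ is stable if for all $x\in J$, $a\in S$: $(x,xa)\in\mathscr J\Rightarrow(x,xa)\in\mathscr R$ and $(x,ax)\in\mathscr J\Rightarrow(x,ax)\in\mathscr L$. A chain of ideals of height $\xi$ is a regular partial semigroup all of whose $\mathscr J$-classes are stable and whose $\mathscr J=\mathscr D$-classes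 form a chain $D_0<D_1<\cdots$ of order type $\xi$. Green's relations on the $I_r$ are the restrictions of those on $U$. **Congruences.** A congruence on $S$ is an equivalence contained in $\sim$ and compatible with all defined left and right multiplications. $\operatorname{Cong}(S)$ is the lattice of congruences; $\operatorname{Cong}_{\mathscr H}(S)$ is the set of congruences contained in $\mathscr H$. $\Omega^\sharp_S$ (or $(x,y)^\sharp_S$) is the congruence on $S$ generated by $\Omega$ (or $(x,y)$). $\Delta_X$ is equality; $\widetilde\nabla_S=\{(x,y):x\sim y\}$; $R_I^S=\widetilde\nabla_I\cup\Delta_S$ for an ideal $I$. For $N$ a normal subgroup of a group $\mathscr H$-class in a stable regular $\mathscr J$-class $D$, $\nu_N=\{(axb,ayb):x,y\in N,\ a,b\in S^1,\ axb,ayb\in D\}$; if $D$ is minimal among the $\mathscr J$-classes in $S\setminus I$, $R^S_{I,N}=R^S_I\cup\nu_N$. A congruence $\sigma$ on an ideal $S$ of $T$ is liftable to $T$ if $\sigma\cup\Delta_T\in\operatorname{Cong}(T)$. **NZ-tuples.** $\zeta_S$ is the largest congruence on $S$ contained in $\mathscr H$. For $S=I_r$: $Z_q=\{g\in G_q:(\mathrm{id}_{G_q},g)\in\zeta_S\}\unlhd G_q$ (so $\zeta_S{\restriction}_{D_q}=\nu_{Z_q}$). For $p\le q$ and $N\unlhd G_q$ with $N\le Z_q$, $N^{\downarrow_p}=\{g\in G_p:(\mathrm{id}_{G_p},g)\in(\nu_N)^\sharp_S\}\unlhd G_p$ (so $(\nu_N)_S^\sharp{\restriction}_{D_p}=\nu_{N^{\downarrow_p}}$).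 An NZ-tuple in $I_r$ is a tuple $\mathbf N=(N_0,N_1,\ldots)$ indexed by the $\mathscr D$-classes of $I_r$ with $N_q\unlhd G_q$, $N_q\le Z_q$ for all $q$, and $N_q^{\downarrow_p}\le N_p$ for all $p\le q$. $\Theta^{I_r}(\mathbf N)=\nu_{N_0}\cup\nu_{N_1}\cup\cdots$. For $\theta\in\operatorname{Cong}_{\mathscr H}(I_r)$, $\mathbf N(\theta)$ is the unique NZ-tuple with $\theta=\Theta^{I_r}(\mathbf N(\theta))$, and $\mathbf N(\theta)_q$ is its $q$-th entry. **Properties.** $\mathcal D\mathsf{max}(T)$: $T$ has a maximum $\mathscr J$-class, regular and stable, denoted $D_T$. $\nabla\mathsf{gen}(T)$: $\mathcal D\mathsf{max}(T)$ holds and for any $x\in D_T$, $y\in T\setminus H_x^T$ with $x\sim y$, $(x,y)^\sharp_T=\widetilde\nabla_T$. $\mathsf{Sep}^\zeta(T)$: $\mathcal D\mathsf{max}(T)$ holds, $S=T\setminus D_T$ is an ideal satisfying $\mathcal D\mathsf{max}(S)$, and: (S1) for $x\in D_T$, $y\in S$ with $x\sim y$ there is $(x',y')\in(x,y)^\sharp_T$ with $x'\in D_S$, $y'\in S\setminus H^S_{x'}$; (S2) for $x\in D_T$, $y\in D_T\setminus H_x^T$ with $x\sim y$ there is $(x',y')\in(x,y)^\sharp_T$ with $x'\in D_T$, $y'\in S$; (S3)$^\zeta$ for $x,y\in D_T$ with $(x,y)\in\mathscr H^T\setminus\zeta_T$ there is $(x',y')\in(x,y)^\sharp_T$ with $x'\in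 D_S$, $y'\in S\setminus H^S_{x'}$. *)

theory Defs
  imports Complex_Main "HOL-Algebra.Coset" "HOL-Library.Extended_Nat"
begin

section \<open>Partial semigroups\<close>

text \<open>
  The partial product is rendered by a total function; \<open>x \<star>\<^bsub>S\<^esub> y\<close> is meaningful only when
  \<open>tgt S x = src S y\<close>, and every definition below uses it under that condition only.
\<close>

record ('a, 'c) partial_semigroup = "'a partial_object" +
  objects :: "'c set"
  src :: "'a \<Rightarrow> 'c"
  tgt :: "'a \<Rightarrow> 'c"
  pmult :: "'a \<Rightarrow> 'a \<Rightarrow> 'a"  (infixl \<open>\<star>\<index>\<close> 70)

locale is_partial_semigroup =
  fixes S :: "('a, 'c) partial_semigroup" (structure)
  assumes src_closed: "x \<in> carrier S \<Longrightarrow> src S x \<in> objects S"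
    and tgt_closed: "x \<in> carrier S \<Longrightarrow> tgt S x \<in> objects S"
    and mult_closed: "\<lbrakk>x \<in> carrier S; y \<in> carrier S; tgt S x = src S y\<rbrakk> \<Longrightarrow> x \<star> y \<in> carrier S"
    and src_mult: "\<lbrakk>x \<in> carrier S; y \<in> carrier S; tgt S x = src S y\<rbrakk> \<Longrightarrow> src S (x \<star> y) = src S x"
    and tgt_mult: "\<lbrakk>x \<in> carrier S; y \<in> carrier S; tgt S x = src S y\<rbrakk> \<Longrightarrow> tgt S (x \<star> y) = tgt S y"
    and mult_assoc: "\<lbrakk>x \<in> carrier S; y \<in> carrier S; z \<in> carrier S; tgt S x = src S y; tgt S y = src S z\<rbrakk>
                      \<Longrightarrow> (x \<star> y) \<star> z = x \<star> (y \<star> z)"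

definition identity_at :: "('a, 'c) partial_semigroup \<Rightarrow> 'c \<Rightarrow> 'a \<Rightarrow> bool" where
  "identity_at S c e \<longleftrightarrow> e \<in> carrier S \<and> src S e = c \<and> tgt S e = c \<and>
     (\<forall>x \<in> carrier S. (src S x = c \<longrightarrow> e \<star>\<^bsub>S\<^esub> x = x) \<and> (tgt S x = c \<longrightarrow> x \<star>\<^bsub>S\<^esub> e = x))"

text \<open>
  The category \<open>S\<^sup>1\<close>: \<open>Inl x\<close> is the element \<open>x\<close> of \<open>S\<close>, and \<open>Inr c\<close> is an identity adjoined at an
  object \<open>c\<close> at which \<open>S\<close> has none.
\<close>

definition adjoin_ids :: "('a, 'c) partial_semigroup \<Rightarrow> ('a + 'c, 'c) partial_semigroup" where
  "adjoin_ids S =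
     \<lparr> carrier = Inl ` carrier S \<union> Inr ` {c \<in> objects S. \<nexists>e. identity_at S c e},
       objects = objects S,
       src = case_sum (src S) id,
       tgt = case_sum (tgt S) id,
       pmult = (\<lambda>a b. case a of Inr _ \<Rightarrow> b
                      | Inl x \<Rightarrow> (case b of Inr _ \<Rightarrow> a | Inl y \<Rightarrow> Inl (x \<star>\<^bsub>S\<^esub> y))) \<rparr>"

abbreviation restrict_to :: "('a, 'c) partial_semigroup \<Rightarrow> 'a set \<Rightarrow> ('a, 'c) partial_semigroup" where
  "restrict_to S I \<equiv> S\<lparr>carrier := I\<rparr>"

definition parallel :: "('a, 'c) partial_semigroup \<Rightarrow> 'a \<Rightarrow> 'a \<Rightarrow> bool" where
  "parallel S x y \<longleftrightarrow> src S x = src S y \<and> tgt S x = tgt S y"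

definition is_ideal :: "('a, 'c) partial_semigroup \<Rightarrow> 'a set \<Rightarrow> bool" where
  "is_ideal S I \<longleftrightarrow> I \<noteq> {} \<and> I \<subseteq> carrier S \<and>
     (\<forall>x \<in> I. \<forall>s \<in> carrier S. (tgt S s = src S x \<longrightarrow> s \<star>\<^bsub>S\<^esub> x \<in> I) \<and>
                             (tgt S x = src S s \<longrightarrow> x \<star>\<^bsub>S\<^esub> s \<in> I))"

definition regular_elem :: "('a, 'c) partial_semigroup \<Rightarrow> 'a \<Rightarrow> bool" where
  "regular_elem S x \<longleftrightarrow>
     (\<exists>a \<in> carrier S. tgt S x = src S a \<and> tgt S a = src S x \<and> x = x \<star>\<^bsub>S\<^esub> a \<star>\<^bsub>S\<^esub> x)"

section \<open>Green's relations\<close>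

text \<open>The principal one- and two-sided ideals \<open>x S\<^sup>1\<close>, \<open>S\<^sup>1 x\<close> and \<open>S\<^sup>1 x S\<^sup>1\<close>, as subsets of \<open>S\<^sup>1\<close>.\<close>

definition right_ideal :: "('a, 'c) partial_semigroup \<Rightarrow> 'a \<Rightarrow> ('a + 'c) set" where
  "right_ideal S x = {Inl x \<star>\<^bsub>adjoin_ids S\<^esub> s | s. s \<in> carrier (adjoin_ids S) \<and>
                        tgt (adjoin_ids S) (Inl x) = src (adjoin_ids S) s}"

definition left_ideal :: "('a, 'c) partial_semigroup \<Rightarrow> 'a \<Rightarrow> ('a + 'c) set" where
  "left_ideal S x = {s \<star>\<^bsub>adjoin_ids S\<^esub> Inl x | s. s \<in> carrier (adjoin_ids S) \<and>
                        tgt (adjoin_ids S) s = src (adjoin_ids S) (Inl x)}"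

definition two_sided_ideal :: "('a, 'c) partial_semigroup \<Rightarrow> 'a \<Rightarrow> ('a + 'c) set" where
  "two_sided_ideal S x = {s \<star>\<^bsub>adjoin_ids S\<^esub> Inl x \<star>\<^bsub>adjoin_ids S\<^esub> t | s t.
      s \<in> carrier (adjoin_ids S) \<and> t \<in> carrier (adjoin_ids S) \<and>
      tgt (adjoin_ids S) s = src (adjoin_ids S) (Inl x) \<and>
      tgt (adjoin_ids S) (Inl x) = src (adjoin_ids S) t}"

definition green_R :: "('a, 'c) partial_semigroup \<Rightarrow> 'a rel" where
  "green_R S = {(x, y). x \<in> carrier S \<and> y \<in> carrier S \<and> right_ideal S x = right_ideal S y}"

definition green_L :: "('a, 'c) partial_semigroup \<Rightarrow> 'a rel" where
  "green_L S = {(x, y). x \<in> carrier S \<and> y \<in> carrier S \<and> left_ideal S x = left_ideal S y}"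

definition green_J :: "('a, 'c) partial_semigroup \<Rightarrow> 'a rel" where
  "green_J S = {(x, y). x \<in> carrier S \<and> y \<in> carrier S \<and> two_sided_ideal S x = two_sided_ideal S y}"

definition green_H :: "('a, 'c) partial_semigroup \<Rightarrow> 'a rel" where
  "green_H S = green_R S \<inter> green_L S"

text \<open>The join of \<open>\<R>\<close> and \<open>\<L>\<close> in the lattice of equivalence relations.\<close>

definition green_D :: "('a, 'c) partial_semigroup \<Rightarrow> 'a rel" where
  "green_D S = (green_R S \<union> green_L S)\<^sup>+"

definition J_class_le :: "('a, 'c) partial_semigroup \<Rightarrow> 'a set \<Rightarrow> 'a set \<Rightarrow> bool" where
  "J_class_le S A B \<longleftrightarrow> (\<forall>x \<in> A. \<forall>y \<in> B. Inl x \<in> two_sided_ideal S y)"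

definition J_class_less :: "('a, 'c) partial_semigroup \<Rightarrow> 'a set \<Rightarrow> 'a set \<Rightarrow> bool" where
  "J_class_less S A B \<longleftrightarrow> J_class_le S A B \<and> A \<noteq> B"

definition stable_class :: "('a, 'c) partial_semigroup \<Rightarrow> 'a set \<Rightarrow> bool" where
  "stable_class S J \<longleftrightarrow> (\<forall>x \<in> J. \<forall>a \<in> carrier S.
     (tgt S x = src S a \<longrightarrow> (x, x \<star>\<^bsub>S\<^esub> a) \<in> green_J S \<longrightarrow> (x, x \<star>\<^bsub>S\<^esub> a) \<in> green_R S) \<and>
     (tgt S a = src S x \<longrightarrow> (x, a \<star>\<^bsub>S\<^esub> x) \<in> green_J S \<longrightarrow> (x, a \<star>\<^bsub>S\<^esub> x) \<in> green_L S))"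

text \<open>
  The \<open>\<J>\<close>-classes of \<open>U\<close> are listed as \<open>D 0 < D 1 < \<dots>\<close>, with index set \<open>{q. enat q < \<xi>}\<close>;
  \<open>\<xi> = \<infinity>\<close> stands for the ordinal \<open>\<omega>\<close>.
\<close>

definition chain_of_ideals :: "('a, 'c) partial_semigroup \<Rightarrow> enat \<Rightarrow> (nat \<Rightarrow> 'a set) \<Rightarrow> bool" where
  "chain_of_ideals U \<xi> D \<longleftrightarrow>
     is_partial_semigroup U \<and> 1 \<le> \<xi> \<and>
     (\<forall>x \<in> carrier U. regular_elem U x) \<and>
     (\<forall>J \<in> carrier U // green_J U. stable_class U J) \<and>
     green_J U = green_D U \<and>
     carrier U // green_J U = D ` {q. enat q < \<xi>} \<and>
     (\<forall>p q. p < q \<longrightarrow> enat q < \<xi> \<longrightarrow> J_class_less U (D p) (D q))"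

definition ideal_up_to :: "(nat \<Rightarrow> 'a set) \<Rightarrow> enat \<Rightarrow> 'a set" where
  "ideal_up_to D r = (\<Union>q \<in> {q. enat q \<le> r}. D q)"

section \<open>Congruences\<close>

definition is_congruence :: "('a, 'c) partial_semigroup \<Rightarrow> 'a rel \<Rightarrow> bool" where
  "is_congruence S \<sigma> \<longleftrightarrow> equiv (carrier S) \<sigma> \<and>
     (\<forall>(x, y) \<in> \<sigma>. parallel S x y \<and>
        (\<forall>s \<in> carrier S. (tgt S x = src S s \<longrightarrow> (x \<star>\<^bsub>S\<^esub> s, y \<star>\<^bsub>S\<^esub> s) \<in> \<sigma>) \<and>
                         (tgt S s = src S x \<longrightarrow> (s \<star>\<^bsub>S\<^esub> x, s \<star>\<^bsub>S\<^esub> y) \<in> \<sigma>)))"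

definition Cong :: "('a, 'c) partial_semigroup \<Rightarrow> 'a rel set" where
  "Cong S = {\<sigma>. is_congruence S \<sigma>}"

definition Cong_H :: "('a, 'c) partial_semigroup \<Rightarrow> 'a rel set" where
  "Cong_H S = {\<sigma> \<in> Cong S. \<sigma> \<subseteq> green_H S}"

definition cong_gen :: "('a, 'c) partial_semigroup \<Rightarrow> 'a rel \<Rightarrow> 'a rel" where
  "cong_gen S \<Omega> = is_congruence S hull \<Omega>"

definition nabla :: "('a, 'c) partial_semigroup \<Rightarrow> 'a rel" where
  "nabla S = {(x, y). x \<in> carrier S \<and> y \<in> carrier S \<and> parallel S x y}"

definition rees_cong :: "('a, 'c) partial_semigroup \<Rightarrow> 'a set \<Rightarrow> 'a rel" where
  "rees_cong S I = nabla (restrict_to S I) \<union> Id_on (carrier S)"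

definition liftable :: "('a, 'c) partial_semigroup \<Rightarrow> 'a rel \<Rightarrow> bool" where
  "liftable T \<sigma> \<longleftrightarrow> \<sigma> \<union> Id_on (carrier T) \<in> Cong T"

definition zeta :: "('a, 'c) partial_semigroup \<Rightarrow> 'a rel" where
  "zeta S = (GREATEST \<sigma>. \<sigma> \<in> Cong_H S)"

section \<open>Group H-classes\<close>

definition H_group :: "('a, 'c) partial_semigroup \<Rightarrow> 'a set \<Rightarrow> 'a monoid" where
  "H_group S G = \<lparr> carrier = G, mult = pmult S,
     one = (THE e. e \<in> G \<and> (\<forall>x \<in> G. e \<star>\<^bsub>S\<^esub> x = x \<and> x \<star>\<^bsub>S\<^esub> e = x)) \<rparr>"

definition group_H_class :: "('a, 'c) partial_semigroup \<Rightarrow> 'a set \<Rightarrow> bool" where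
  "group_H_class S G \<longleftrightarrow> G \<in> carrier S // green_H S \<and>
     (\<forall>x \<in> G. \<forall>y \<in> G. tgt S x = src S y) \<and> group (H_group S G)"

text \<open>\<open>nu S D N\<close> is \<open>\<nu>\<^sub>N\<close> for a normal subgroup \<open>N\<close> of a group \<open>\<H>\<close>-class contained in the \<open>\<J>\<close>-class \<open>D\<close>.\<close>

definition nu :: "('a, 'c) partial_semigroup \<Rightarrow> 'a set \<Rightarrow> 'a set \<Rightarrow> 'a rel" where
  "nu S D N = {(u, v). u \<in> D \<and> v \<in> D \<and>
     (\<exists>x \<in> N. \<exists>y \<in> N. \<exists>a \<in> carrier (adjoin_ids S). \<exists>b \<in> carrier (adjoin_ids S).
        tgt (adjoin_ids S) a = src (adjoin_ids S) (Inl x) \<and>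
        tgt (adjoin_ids S) (Inl x) = src (adjoin_ids S) b \<and>
        tgt (adjoin_ids S) a = src (adjoin_ids S) (Inl y) \<and>
        tgt (adjoin_ids S) (Inl y) = src (adjoin_ids S) b \<and>
        Inl u = a \<star>\<^bsub>adjoin_ids S\<^esub> Inl x \<star>\<^bsub>adjoin_ids S\<^esub> b \<and>
        Inl v = a \<star>\<^bsub>adjoin_ids S\<^esub> Inl y \<star>\<^bsub>adjoin_ids S\<^esub> b)}"

definition rees_cong_nu :: "('a, 'c) partial_semigroup \<Rightarrow> 'a set \<Rightarrow> 'a set \<Rightarrow> 'a set \<Rightarrow> 'a rel" where
  "rees_cong_nu S I D N = rees_cong S I \<union> nu S D N"

section \<open>NZ-tuples\<close>

definition Z_group :: "('a, 'c) partial_semigroup \<Rightarrow> 'a set \<Rightarrow> 'a set" where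
  "Z_group S G = {g \<in> G. (\<one>\<^bsub>H_group S G\<^esub>, g) \<in> zeta S}"

text \<open>\<open>down S D Gp N\<close> is \<open>N\<^sup>\<down>\<^sup>p\<close>, where \<open>N\<close> is a normal subgroup of a group \<open>\<H>\<close>-class inside \<open>D\<close> and \<open>Gp\<close> is \<open>G\<^sub>p\<close>.\<close>

definition down :: "('a, 'c) partial_semigroup \<Rightarrow> 'a set \<Rightarrow> 'a set \<Rightarrow> 'a set \<Rightarrow> 'a set" where
  "down S D Gp N = {g \<in> Gp. (\<one>\<^bsub>H_group S Gp\<^esub>, g) \<in> cong_gen S (nu S D N)}"

text \<open>
  Below, \<open>S\<close> is the ideal \<open>I\<^sub>r\<close>, whose classes are indexed by \<open>{q. enat q \<le> r}\<close>. Tuples are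
  \<open>extensional\<close>, i.e. \<open>undefined\<close> off this index set, so that equal tuples are equal functions.
\<close>

definition NZ_tuple ::
  "('a, 'c) partial_semigroup \<Rightarrow> enat \<Rightarrow> (nat \<Rightarrow> 'a set) \<Rightarrow> (nat \<Rightarrow> 'a set) \<Rightarrow> (nat \<Rightarrow> 'a set) \<Rightarrow> bool" where
  "NZ_tuple S r D G N \<longleftrightarrow>
     N \<in> extensional {q. enat q \<le> r} \<and>
     (\<forall>q. enat q \<le> r \<longrightarrow> N q \<lhd> H_group S (G q) \<and> N q \<subseteq> Z_group S (G q)) \<and>
     (\<forall>p q. p \<le> q \<longrightarrow> enat q \<le> r \<longrightarrow> down S (D q) (G p) (N q) \<subseteq> N p)"

definition Theta :: "('a, 'c) partial_semigroup \<Rightarrow> enat \<Rightarrow> (nat \<Rightarrow> 'a set) \<Rightarrow> (nat \<Rightarrow> 'a set) \<Rightarrow> 'a rel" where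
  "Theta S r D N = (\<Union>q \<in> {q. enat q \<le> r}. nu S (D q) (N q))"

definition NZ_of ::
  "('a, 'c) partial_semigroup \<Rightarrow> enat \<Rightarrow> (nat \<Rightarrow> 'a set) \<Rightarrow> (nat \<Rightarrow> 'a set) \<Rightarrow> 'a rel \<Rightarrow> nat \<Rightarrow> 'a set" where
  "NZ_of S r D G \<theta> = (THE N. NZ_tuple S r D G N \<and> \<theta> = Theta S r D N)"

section \<open>The separation properties\<close>

definition is_max_J_class :: "('a, 'c) partial_semigroup \<Rightarrow> 'a set \<Rightarrow> bool" where
  "is_max_J_class T D \<longleftrightarrow> D \<in> carrier T // green_J T \<and> (\<forall>J \<in> carrier T // green_J T. J_class_le T J D)"

definition max_J_class :: "('a, 'c) partial_semigroup \<Rightarrow> 'a set" where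
  "max_J_class T = (THE D. is_max_J_class T D)"

definition Dmax :: "('a, 'c) partial_semigroup \<Rightarrow> bool" where
  "Dmax T \<longleftrightarrow> (\<exists>D. is_max_J_class T D \<and> (\<forall>x \<in> D. regular_elem T x) \<and> stable_class T D)"

definition nabla_gen :: "('a, 'c) partial_semigroup \<Rightarrow> bool" where
  "nabla_gen T \<longleftrightarrow> Dmax T \<and>
     (\<forall>x \<in> max_J_class T. \<forall>y \<in> carrier T - green_H T `` {x}.
        parallel T x y \<longrightarrow> cong_gen T {(x, y)} = nabla T)"

definition Sep_zeta :: "('a, 'c) partial_semigroup \<Rightarrow> bool" where
  "Sep_zeta T \<longleftrightarrow> Dmax T \<and>
    (let D = max_J_class T; I = carrier T - D; S = restrict_to T I; D' = max_J_class S in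
      is_ideal T I \<and> Dmax S \<and>
      (\<forall>x \<in> D. \<forall>y \<in> I. parallel T x y \<longrightarrow>
         (\<exists>(x', y') \<in> cong_gen T {(x, y)}. x' \<in> D' \<and> y' \<in> I - green_H S `` {x'})) \<and>
      (\<forall>x \<in> D. \<forall>y \<in> D - green_H T `` {x}. parallel T x y \<longrightarrow>
         (\<exists>(x', y') \<in> cong_gen T {(x, y)}. x' \<in> D \<and> y' \<in> I)) \<and>
      (\<forall>x \<in> D. \<forall>y \<in> D. (x, y) \<in> green_H T - zeta T \<longrightarrow>
         (\<exists>(x', y') \<in> cong_gen T {(x, y)}. x' \<in> D' \<and> y' \<in> I - green_H S `` {x'})))"

end

theory Submission
  imports Defs
begin

text \<open>
  In a regular partial semigroup Green's relations can be expressed without adjoining identities, so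
  they restrict to ideals. Over a stable \<open>\<J>\<close>-class, Green's lemma transports any pair of a congruence
  inside \<open>\<H>\<close> to a group \<open>\<H>\<close>-class; such a congruence is therefore determined by the normal subgroups
  \<open>N\<^sub>q\<close> of elements related to the identity of \<open>G\<^sub>q\<close>. This gives (i).

  For (ii), let \<open>\<tau>\<close> be a congruence and let \<open>m \<ge> k\<close> be least such that \<open>\<tau>\<close> does not contain the universal
  congruence of \<open>I\<^sub>m\<close>. By (S1), (S2) and induction from \<open>\<nabla>gen\<close>, a \<open>\<tau>\<close>-pair outside \<open>\<H>\<close> whose higher
  member lies in \<open>D\<^sub>s\<close> makes \<open>\<tau>\<close> universal on \<open>I\<^sub>s\<close>; so \<open>\<tau>\<close> lies in \<open>\<H>\<close> from \<open>D\<^sub>m\<close> upwards. By (S3), an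
  \<open>\<H>\<close>-pair in \<open>D\<^sub>s\<close> outside \<open>\<zeta>\<close> makes \<open>\<tau>\<close> universal on \<open>I\<^sub>s\<^sub>-\<^sub>1\<close>; so \<open>\<tau>\<close> lies in \<open>\<zeta>\<close> above \<open>D\<^sub>m\<close>.
  Hence \<open>\<theta> = \<tau> \<inter> \<zeta>\<close> is the required \<open>\<H>\<close>-part.
\<close>

section \<open>Green's relations in a regular partial semigroup\<close>

text \<open>The hypotheses live on different partial semigroups: liftability on \<open>U\<close>,
  \<open>nabla_gen\<close> on \<open>I k\<close>, each \<open>Sep_zeta\<close> on its own
  \<open>I s\<close>, while the conclusion is about \<open>I r\<close>. Each of these has its own
  \<H>, \<zeta>, maximal class and generated congruences. They become comparable because \<H>, \<J>
  and \<zeta> of an ideal are restrictions of those of the whole, and a congruence generated inside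
  an ideal is contained in every congruence of the whole that contains the generating pair. For
  \<zeta> this rests on the explicit description in \<open>zeta_eq\<close>, since maximality inside
  the ideal does not by itself give compatibility with multipliers outside it.

  The index \<open>m\<close> marks a change of regime of \<tau>: inside \<zeta> above
  \<open>D m\<close>, but on \<open>D m\<close> only inside \<H>. The second family has its extra
  term \<open>nu\<close> for this reason: for \<open>m > k\<close>, (S3) in \<open>D m\<close>
  yields universality on \<open>I (m - 1)\<close>, which \<tau> has anyway, so the subgroup of
  \<open>G m\<close> cut out by \<tau> need not lie in \<open>Z m\<close>. For \<open>m = k\<close>
  no universality below is available, and all of \<open>I k\<close> goes into \<sigma>.\<close>

definition R_le :: "('a, 'c) partial_semigroup \<Rightarrow> 'a \<Rightarrow> 'a \<Rightarrow> bool" where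
  "R_le S x y \<longleftrightarrow> x \<in> carrier S \<and> y \<in> carrier S \<and>
     (\<exists>s \<in> carrier S. tgt S y = src S s \<and> x = y \<star>\<^bsub>S\<^esub> s)"

definition L_le :: "('a, 'c) partial_semigroup \<Rightarrow> 'a \<Rightarrow> 'a \<Rightarrow> bool" where
  "L_le S x y \<longleftrightarrow> x \<in> carrier S \<and> y \<in> carrier S \<and>
     (\<exists>s \<in> carrier S. tgt S s = src S y \<and> x = s \<star>\<^bsub>S\<^esub> y)"

definition J_le :: "('a, 'c) partial_semigroup \<Rightarrow> 'a \<Rightarrow> 'a \<Rightarrow> bool" where
  "J_le S x y \<longleftrightarrow> x \<in> carrier S \<and> y \<in> carrier S \<and>
     (\<exists>a \<in> carrier S. \<exists>b \<in> carrier S. tgt S a = src S y \<and> tgt S y = src S b \<and> x = a \<star>\<^bsub>S\<^esub> y \<star>\<^bsub>S\<^esub> b)"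

locale regular_partial_semigroup = is_partial_semigroup +
  assumes regular: "x \<in> carrier S \<Longrightarrow> regular_elem S x"
begin

lemmas mult_simps = src_mult tgt_mult mult_closed mult_assoc

lemma regularE:
  assumes "x \<in> carrier S"
  obtains a where "a \<in> carrier S" "tgt S x = src S a" "tgt S a = src S x" "x \<star> (a \<star> x) = x"
proof -
  from regular[OF assms] obtain a where
    "a \<in> carrier S" "tgt S x = src S a" "tgt S a = src S x" "x = x \<star> a \<star> x"
    unfolding regular_elem_def by blast
  with that assms show ?thesis by (metis mult_assoc)
qed

lemma R_leD:
  assumes "R_le S x y"
  shows "x \<in> carrier S" "y \<in> carrier S" "src S x = src S y"
  using assms by (auto simp: R_le_def src_mult)

lemma L_leD:
  assumes "L_le S x y"
  shows "x \<in> carrier S" "y \<in> carrier S" "tgt S x = tgt S y"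
  using assms by (auto simp: L_le_def tgt_mult)

lemma J_leD:
  assumes "J_le S x y"
  shows "x \<in> carrier S" "y \<in> carrier S"
  using assms by (auto simp: J_le_def)

lemma R_leI: "\<lbrakk>x \<in> carrier S; s \<in> carrier S; tgt S x = src S s\<rbrakk> \<Longrightarrow> R_le S (x \<star> s) x"
  by (auto simp: R_le_def mult_closed)

lemma L_leI: "\<lbrakk>x \<in> carrier S; s \<in> carrier S; tgt S s = src S x\<rbrakk> \<Longrightarrow> L_le S (s \<star> x) x"
  by (auto simp: L_le_def mult_closed)

lemma R_le_refl: "x \<in> carrier S \<Longrightarrow> R_le S x x"
  by (metis R_leI mult_closed regularE src_mult)

lemma L_le_refl:
  assumes "x \<in> carrier S"
  shows "L_le S x x"
proof -
  from regularE[OF assms] obtain a where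
    a: "x \<in> carrier S" "a \<in> carrier S" "tgt S x = src S a" "tgt S a = src S x" "x \<star> (a \<star> x) = x"
    using assms by blast
  then have "(x \<star> a) \<star> x = x" by (simp add: mult_simps)
  then show "L_le S x x" unfolding L_le_def using a
    by (auto simp: src_mult tgt_mult mult_closed intro!: bexI[of _ "x \<star> a"])
qed

lemma R_le_trans: "R_le S x y \<Longrightarrow> R_le S y z \<Longrightarrow> R_le S x z"
  unfolding R_le_def by (metis mult_assoc mult_closed src_mult tgt_mult)

lemma L_le_trans: "L_le S x y \<Longrightarrow> L_le S y z \<Longrightarrow> L_le S x z"
  unfolding L_le_def by (metis mult_assoc mult_closed src_mult tgt_mult)

lemma R_le_mult:
  assumes "R_le S x y" "a \<in> carrier S" "tgt S a = src S y"
  shows "R_le S (a \<star> x) (a \<star> y)"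
  using assms unfolding R_le_def
  by (auto simp: src_mult tgt_mult mult_closed) (metis mult_assoc)

lemma L_le_mult:
  assumes "L_le S x y" "a \<in> carrier S" "tgt S y = src S a"
  shows "L_le S (x \<star> a) (y \<star> a)"
  using assms unfolding L_le_def
  by (auto simp: src_mult tgt_mult mult_closed) (metis mult_assoc)

lemma J_le_trans:
  assumes "J_le S x y" "J_le S y z"
  shows "J_le S x z"
proof -
  obtain a b where ab: "x \<in> carrier S" "y \<in> carrier S" "a \<in> carrier S" "b \<in> carrier S" "tgt S a = src S y"
    "tgt S y = src S b" "x = a \<star> y \<star> b"
    using assms(1) unfolding J_le_def by blast
  obtain c d where cd: "z \<in> carrier S" "c \<in> carrier S" "d \<in> carrier S" "tgt S c = src S z"
    "tgt S z = src S d" "y = c \<star> z \<star> d"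
    using assms(2) unfolding J_le_def by blast
  have s: "src S y = src S c" "tgt S y = tgt S d"
    using cd by (simp_all add: mult_simps)
  have "x = (a \<star> c) \<star> z \<star> (d \<star> b)"
    using ab cd s by (simp add: mult_simps)
  then show ?thesis
    unfolding J_le_def using ab cd s
    by (intro conjI bexI[of _ "a \<star> c"] bexI[of _ "d \<star> b"]) (simp_all add: mult_simps)
qed

lemma R_le_imp_J_le: "R_le S x y \<Longrightarrow> J_le S x y"
  unfolding R_le_def J_le_def using L_le_refl unfolding L_le_def by metis

lemma L_le_imp_J_le: "L_le S x y \<Longrightarrow> J_le S x y"
proof -
  assume *: "L_le S x y"
  then obtain t where "t \<in> carrier S" "tgt S y = src S t" "y = y \<star> t"
    using R_le_refl unfolding L_le_def R_le_def by blast
  with * show ?thesis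
    unfolding L_le_def J_le_def by (metis mult_assoc)
qed

lemma J_le_refl: "x \<in> carrier S \<Longrightarrow> J_le S x x"
  by (simp add: R_le_refl R_le_imp_J_le)

text \<open>An adjoined identity contributes only \<open>x\<close> itself, and regularity already
  gives \<open>x = x(ax)\<close>. So the principal ideals carry no more information than the
  preorders, whose multipliers stay inside \<open>S\<close>.\<close>

lemma right_ideal_eq: "x \<in> carrier S \<Longrightarrow> right_ideal S x = Inl ` {y. R_le S y x}"
proof
  assume x: "x \<in> carrier S"
  show "right_ideal S x \<subseteq> Inl ` {y. R_le S y x}"
    using x R_le_refl[OF x] by (auto simp: right_ideal_def adjoin_ids_def intro!: imageI R_leI)
  show "Inl ` {y. R_le S y x} \<subseteq> right_ideal S x"
    using x by (force simp: right_ideal_def adjoin_ids_def R_le_def)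
qed

lemma left_ideal_eq: "x \<in> carrier S \<Longrightarrow> left_ideal S x = Inl ` {y. L_le S y x}"
proof
  assume x: "x \<in> carrier S"
  show "left_ideal S x \<subseteq> Inl ` {y. L_le S y x}"
    using x L_le_refl[OF x] by (auto simp: left_ideal_def adjoin_ids_def intro!: imageI L_leI)
  show "Inl ` {y. L_le S y x} \<subseteq> left_ideal S x"
    using x by (force simp: left_ideal_def adjoin_ids_def L_le_def)
qed

lemma J_leI:
  "\<lbrakk>x \<in> carrier S; a \<in> carrier S; b \<in> carrier S; tgt S a = src S x; tgt S x = src S b\<rbrakk>
    \<Longrightarrow> J_le S (a \<star> x \<star> b) x"
  unfolding J_le_def by (auto simp: mult_closed src_mult tgt_mult)

lemma two_sided_ideal_eq: "x \<in> carrier S \<Longrightarrow> two_sided_ideal S x = Inl ` {y. J_le S y x}"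
proof
  assume x: "x \<in> carrier S"
  show "two_sided_ideal S x \<subseteq> Inl ` {y. J_le S y x}"
    using x J_le_refl[OF x] R_le_imp_J_le[OF R_leI[OF x]] L_le_imp_J_le[OF L_leI[OF x]]
    by (auto simp: two_sided_ideal_def adjoin_ids_def J_leI)
  show "Inl ` {y. J_le S y x} \<subseteq> two_sided_ideal S x"
  proof (clarify)
    fix y assume "J_le S y x"
    then obtain a b where "a \<in> carrier S" "b \<in> carrier S" "tgt S a = src S x" "tgt S x = src S b" "y = a \<star> x \<star> b"
      unfolding J_le_def by blast
    then show "Inl y \<in> two_sided_ideal S x"
      unfolding two_sided_ideal_def
      by (intro CollectI exI[of _ "Inl a"] exI[of _ "Inl b"]) (simp add: adjoin_ids_def)
  qed
qed

lemma green_R_iff: "(x, y) \<in> green_R S \<longleftrightarrow> R_le S x y \<and> R_le S y x"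
proof
  assume "(x, y) \<in> green_R S"
  then have xy: "x \<in> carrier S" "y \<in> carrier S" "{z. R_le S z x} = {z. R_le S z y}"
    unfolding green_R_def by (auto simp: right_ideal_eq inj_image_eq_iff)
  then show "R_le S x y \<and> R_le S y x" using R_le_refl by blast
next
  assume "R_le S x y \<and> R_le S y x"
  then show "(x, y) \<in> green_R S"
    unfolding green_R_def
    by (auto simp: right_ideal_eq R_leD intro: R_le_trans intro!: imageI)
qed

lemma green_L_iff: "(x, y) \<in> green_L S \<longleftrightarrow> L_le S x y \<and> L_le S y x"
proof
  assume "(x, y) \<in> green_L S"
  then have xy: "x \<in> carrier S" "y \<in> carrier S" "{z. L_le S z x} = {z. L_le S z y}"
    unfolding green_L_def by (auto simp: left_ideal_eq inj_image_eq_iff)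
  then show "L_le S x y \<and> L_le S y x" using L_le_refl by blast
next
  assume "L_le S x y \<and> L_le S y x"
  then show "(x, y) \<in> green_L S"
    unfolding green_L_def
    by (auto simp: left_ideal_eq L_leD intro: L_le_trans intro!: imageI)
qed

lemma green_J_iff: "(x, y) \<in> green_J S \<longleftrightarrow> J_le S x y \<and> J_le S y x"
proof
  assume "(x, y) \<in> green_J S"
  then have xy: "x \<in> carrier S" "y \<in> carrier S" "{z. J_le S z x} = {z. J_le S z y}"
    unfolding green_J_def by (auto simp: two_sided_ideal_eq inj_image_eq_iff)
  then show "J_le S x y \<and> J_le S y x" using J_le_refl by blast
next
  assume "J_le S x y \<and> J_le S y x"
  then show "(x, y) \<in> green_J S"
    unfolding green_J_def
    by (auto simp: two_sided_ideal_eq J_leD intro: J_le_trans intro!: imageI)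
qed

lemma green_H_iff:
  "(x, y) \<in> green_H S \<longleftrightarrow> R_le S x y \<and> R_le S y x \<and> L_le S x y \<and> L_le S y x"
  by (auto simp: green_H_def green_R_iff green_L_iff)

lemma green_HD:
  assumes "(x, y) \<in> green_H S"
  shows "x \<in> carrier S" "y \<in> carrier S" "src S x = src S y" "tgt S x = tgt S y"
  using assms by (auto simp: green_H_iff dest: R_leD L_leD)

lemma green_H_sym: "(x, y) \<in> green_H S \<Longrightarrow> (y, x) \<in> green_H S"
  by (simp add: green_H_iff)

lemma green_H_trans: "(x, y) \<in> green_H S \<Longrightarrow> (y, z) \<in> green_H S \<Longrightarrow> (x, z) \<in> green_H S"
  by (meson green_H_iff R_le_trans L_le_trans)

lemma green_H_refl: "x \<in> carrier S \<Longrightarrow> (x, x) \<in> green_H S"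
  by (simp add: green_H_iff R_le_refl L_le_refl)

lemma green_H_imp_J: "(x, y) \<in> green_H S \<Longrightarrow> (x, y) \<in> green_J S"
  by (simp add: green_H_iff green_J_iff R_le_imp_J_le)

lemma equiv_green_J: "equiv (carrier S) (green_J S)"
  by (rule equivI) (auto simp: green_J_def refl_on_def sym_def trans_def)

lemma J_class_eq: "J \<in> carrier S // green_J S \<Longrightarrow> x \<in> J \<Longrightarrow> J = {y. (x, y) \<in> green_J S}"
  using equiv_green_J by (auto simp: quotient_def green_J_def)

lemma J_le_mult:
  assumes "x \<in> carrier S" "s \<in> carrier S"
  shows "tgt S x = src S s \<Longrightarrow> J_le S (x \<star> s) x" "tgt S s = src S x \<Longrightarrow> J_le S (s \<star> x) x"
  using assms by (simp_all add: R_leI L_leI R_le_imp_J_le L_le_imp_J_le)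

lemma ideal_J_le: "is_ideal S I \<Longrightarrow> y \<in> I \<Longrightarrow> J_le S x y \<Longrightarrow> x \<in> I"
  unfolding is_ideal_def J_le_def by (metis mult_closed tgt_mult subsetD)

text \<open>With \<open>x = xax\<close>, the element \<open>f = xa\<close> is a left identity on all
  products \<open>xs\<close>, hence on the \<H>-class of \<open>x\<close>. Being \<J>-below
  \<open>x\<close>, it belongs to every ideal containing \<open>x\<close>; this lets outside
  multipliers be pulled into the ideal.\<close>

lemma green_H_idempotent_left:
  assumes "x \<in> carrier S"
  obtains f where "f \<in> carrier S" "src S f = src S x" "tgt S f = src S x" "J_le S f x"
    "\<And>y. (x, y) \<in> green_H S \<Longrightarrow> f \<star> y = y"
proof -
  from regularE[OF assms] obtain a where
    a: "a \<in> carrier S" "tgt S x = src S a" "tgt S a = src S x" "x \<star> (a \<star> x) = x" .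
  have "(x \<star> a) \<star> y = y" if H: "(x, y) \<in> green_H S" for y
  proof -
    obtain s where s: "s \<in> carrier S" "tgt S x = src S s" "y = x \<star> s"
      using H unfolding green_H_iff R_le_def by blast
    then have "(x \<star> a) \<star> y = (x \<star> (a \<star> x)) \<star> s"
      using a(1-3) assms by (simp add: mult_simps)
    then show ?thesis using a s by simp
  qed
  then show ?thesis using that[of "x \<star> a"] a assms by (simp add: mult_simps J_le_mult)
qed

lemma green_H_idempotent_right:
  assumes "x \<in> carrier S"
  obtains f where "f \<in> carrier S" "src S f = tgt S x" "tgt S f = tgt S x" "J_le S f x"
    "\<And>y. (x, y) \<in> green_H S \<Longrightarrow> y \<star> f = y"
proof -
  from regularE[OF assms] obtain a where
    a: "a \<in> carrier S" "tgt S x = src S a" "tgt S a = src S x" "x \<star> (a \<star> x) = x" .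
  have "y \<star> (a \<star> x) = y" if H: "(x, y) \<in> green_H S" for y
  proof -
    obtain s where s: "s \<in> carrier S" "tgt S s = src S x" "y = s \<star> x"
      using H unfolding green_H_iff L_le_def by blast
    then have "y \<star> (a \<star> x) = s \<star> (x \<star> (a \<star> x))"
      using a(1-3) assms by (simp add: mult_simps)
    then show ?thesis using a s by simp
  qed
  then show ?thesis using that[of "a \<star> x"] a assms by (simp add: mult_simps J_le_mult)
qed

end

section \<open>Congruences, ideals and \<open>\<zeta>\<close>\<close>

lemma congD:
  assumes "\<sigma> \<in> Cong S" "(x, y) \<in> \<sigma>"
  shows "x \<in> carrier S" "y \<in> carrier S" "src S x = src S y" "tgt S x = tgt S y" "(y, x) \<in> \<sigma>"
proof -
  have e: "equiv (carrier S) \<sigma>" and p: "parallel S x y"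
    using assms by (auto simp: Cong_def is_congruence_def)
  show "x \<in> carrier S" "y \<in> carrier S" "(y, x) \<in> \<sigma>"
    using e assms(2) by (auto simp: equiv_def sym_def refl_on_def)
  show "src S x = src S y" "tgt S x = tgt S y" using p by (auto simp: parallel_def)
qed

lemma cong_trans: "\<sigma> \<in> Cong S \<Longrightarrow> (x, y) \<in> \<sigma> \<Longrightarrow> (y, z) \<in> \<sigma> \<Longrightarrow> (x, z) \<in> \<sigma>"
  by (auto simp: Cong_def is_congruence_def equiv_def dest: transD)

lemma cong_refl: "\<sigma> \<in> Cong S \<Longrightarrow> x \<in> carrier S \<Longrightarrow> (x, x) \<in> \<sigma>"
  by (auto simp: Cong_def is_congruence_def equiv_def dest: refl_onD)

lemma cong_mult_right:
  "\<sigma> \<in> Cong S \<Longrightarrow> (x, y) \<in> \<sigma> \<Longrightarrow> s \<in> carrier S \<Longrightarrow> tgt S x = src S s \<Longrightarrow> (x \<star>\<^bsub>S\<^esub> s, y \<star>\<^bsub>S\<^esub> s) \<in> \<sigma>"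
  by (auto simp: Cong_def is_congruence_def)

lemma cong_mult_left:
  "\<sigma> \<in> Cong S \<Longrightarrow> (x, y) \<in> \<sigma> \<Longrightarrow> s \<in> carrier S \<Longrightarrow> tgt S s = src S x \<Longrightarrow> (s \<star>\<^bsub>S\<^esub> x, s \<star>\<^bsub>S\<^esub> y) \<in> \<sigma>"
  by (auto simp: Cong_def is_congruence_def)

text \<open>Carrier membership is asked of the first component only; symmetry supplies it for the
  second.\<close>

lemma CongI:
  assumes "\<And>x y. (x, y) \<in> \<sigma> \<Longrightarrow> x \<in> carrier S \<and> parallel S x y \<and> (y, x) \<in> \<sigma>"
    and "\<And>x. x \<in> carrier S \<Longrightarrow> (x, x) \<in> \<sigma>"
    and "\<And>x y z. (x, y) \<in> \<sigma> \<Longrightarrow> (y, z) \<in> \<sigma> \<Longrightarrow> (x, z) \<in> \<sigma>"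
    and "\<And>x y s. \<lbrakk>(x, y) \<in> \<sigma>; s \<in> carrier S; tgt S x = src S s\<rbrakk> \<Longrightarrow> (x \<star>\<^bsub>S\<^esub> s, y \<star>\<^bsub>S\<^esub> s) \<in> \<sigma>"
    and "\<And>x y s. \<lbrakk>(x, y) \<in> \<sigma>; s \<in> carrier S; tgt S s = src S x\<rbrakk> \<Longrightarrow> (s \<star>\<^bsub>S\<^esub> x, s \<star>\<^bsub>S\<^esub> y) \<in> \<sigma>"
  shows "\<sigma> \<in> Cong S"
proof -
  have in1: "x \<in> carrier S" and par: "parallel S x y" and sy: "(y, x) \<in> \<sigma>" if "(x, y) \<in> \<sigma>" for x y
    using assms(1) that by simp_all
  have "\<sigma> \<subseteq> carrier S \<times> carrier S"
    using in1 in1[OF sy] by (intro subrelI) simp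
  moreover have "sym \<sigma>" using sy by (rule symI)
  moreover have "refl_on (carrier S) \<sigma>" using assms(2) by (rule refl_onI)
  moreover have "trans \<sigma>" using assms(3) by (rule transI)
  ultimately show ?thesis
    unfolding Cong_def is_congruence_def equiv_def using par assms(4,5) by fastforce
qed

lemma Cong_Int: "\<sigma> \<in> Cong S \<Longrightarrow> \<tau> \<in> Cong S \<Longrightarrow> \<sigma> \<inter> \<tau> \<in> Cong S"
  by (rule CongI) (auto dest: congD cong_trans intro: cong_refl cong_mult_left cong_mult_right simp: parallel_def)

lemma Cong_restrict:
  assumes "\<tau> \<in> Cong S" "is_ideal S I"
  shows "\<tau> \<inter> I \<times> I \<in> Cong (restrict_to S I)"
  using assms
  by (intro CongI)
    (auto simp: parallel_def is_ideal_def subset_iff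
      intro: cong_refl cong_mult_left cong_mult_right congD cong_trans dest: congD(3,4))

lemma cong_gen_subset: "\<tau> \<in> Cong S \<Longrightarrow> \<Omega> \<subseteq> \<tau> \<Longrightarrow> cong_gen S \<Omega> \<subseteq> \<tau>"
  unfolding cong_gen_def Cong_def by (simp add: hull_minimal)

lemma cong_genI: "(\<And>\<tau>. \<tau> \<in> Cong S \<Longrightarrow> \<Omega> \<subseteq> \<tau> \<Longrightarrow> p \<in> \<tau>) \<Longrightarrow> p \<in> cong_gen S \<Omega>"
  unfolding cong_gen_def Cong_def hull_def by blast

text \<open>The restriction of \<tau> to the ideal is a congruence there and contains the pair. Thus
  the pairs that a separation property produces inside a smaller ideal are again
  \<tau>-pairs.\<close>

lemma cong_gen_in_ideal:
  assumes "\<tau> \<in> Cong S" "is_ideal S I" "(x, y) \<in> \<tau>" "x \<in> I" "y \<in> I"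
  shows "cong_gen (restrict_to S I) {(x, y)} \<subseteq> \<tau>"
  using cong_gen_subset[OF Cong_restrict[OF assms(1,2)], of "{(x, y)}"] assms by auto

context is_partial_semigroup
begin

lemma nabla_Cong: "nabla S \<in> Cong S"
  by (rule CongI) (auto simp: nabla_def parallel_def mult_closed src_mult tgt_mult)

end

section \<open>Green's relations and \<zeta> of an ideal\<close>

context regular_partial_semigroup
begin

lemma restrict_regular:
  assumes "is_ideal S I"
  shows "regular_partial_semigroup (restrict_to S I)"
proof
  have sub: "x \<in> carrier S" if "x \<in> I" for x using assms that by (auto simp: is_ideal_def)
  have id: "x \<star> y \<in> I" if "x \<in> carrier S" "y \<in> carrier S" "tgt S x = src S y" "x \<in> I \<or> y \<in> I" for x y
    using assms that by (auto simp: is_ideal_def)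
  let ?T = "restrict_to S I"
  fix x y z
  show "x \<in> carrier ?T \<Longrightarrow> src ?T x \<in> objects ?T" by (simp add: sub src_closed)
  show "x \<in> carrier ?T \<Longrightarrow> tgt ?T x \<in> objects ?T" by (simp add: sub tgt_closed)
  show "\<lbrakk>x \<in> carrier ?T; y \<in> carrier ?T; tgt ?T x = src ?T y\<rbrakk> \<Longrightarrow> x \<star>\<^bsub>?T\<^esub> y \<in> carrier ?T"
    by (simp add: id sub)
  show "\<lbrakk>x \<in> carrier ?T; y \<in> carrier ?T; tgt ?T x = src ?T y\<rbrakk> \<Longrightarrow> src ?T (x \<star>\<^bsub>?T\<^esub> y) = src ?T x"
    by (simp add: src_mult sub)
  show "\<lbrakk>x \<in> carrier ?T; y \<in> carrier ?T; tgt ?T x = src ?T y\<rbrakk> \<Longrightarrow> tgt ?T (x \<star>\<^bsub>?T\<^esub> y) = tgt ?T y"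
    by (simp add: tgt_mult sub)
  show "\<lbrakk>x \<in> carrier ?T; y \<in> carrier ?T; z \<in> carrier ?T; tgt ?T x = src ?T y; tgt ?T y = src ?T z\<rbrakk>
    \<Longrightarrow> x \<star>\<^bsub>?T\<^esub> y \<star>\<^bsub>?T\<^esub> z = x \<star>\<^bsub>?T\<^esub> (y \<star>\<^bsub>?T\<^esub> z)"
    by (simp add: mult_assoc sub)
  assume "x \<in> carrier ?T"
  then have x: "x \<in> I" "x \<in> carrier S" by (simp_all add: sub)
  from regularE[OF x(2)] obtain a where
    a: "a \<in> carrier S" "tgt S x = src S a" "tgt S a = src S x" "x \<star> (a \<star> x) = x" .
  \<comment> \<open>A regularity witness inside the ideal is \<open>axa\<close>: it contains the
    factor \<open>x\<close>, and \<open>x(axa)x = x\<close>.\<close>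
  have "x \<star> (a \<star> (x \<star> (a \<star> x))) = x" using a by simp
  then have "x \<star> (a \<star> x \<star> a) \<star> x = x" using x a(1-3) by (simp add: mult_simps)
  moreover have "a \<star> x \<star> a \<in> I" using x a(1-3) by (simp add: id mult_simps)
  ultimately show "regular_elem ?T x"
    using x a(1-3) unfolding regular_elem_def
    by (intro bexI[of _ "a \<star> x \<star> a"]) (simp_all add: src_mult tgt_mult mult_closed)
qed

context
  fixes I assumes ideal: "is_ideal S I"
begin

lemma ideal_carrier: "x \<in> I \<Longrightarrow> x \<in> carrier S"
  using ideal by (auto simp: is_ideal_def)

text \<open>If \<open>x = ys\<close> and \<open>f\<close> is a right identity of \<open>y\<close> in
  the ideal, then \<open>x = y(fs)\<close>, and the multiplier \<open>fs\<close> lies in the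
  ideal.\<close>

lemma R_le_restrict: "R_le (restrict_to S I) x y \<longleftrightarrow> x \<in> I \<and> y \<in> I \<and> R_le S x y"
proof
  show "R_le (restrict_to S I) x y \<Longrightarrow> x \<in> I \<and> y \<in> I \<and> R_le S x y"
    by (auto simp: R_le_def ideal_carrier)
  assume *: "x \<in> I \<and> y \<in> I \<and> R_le S x y"
  then obtain s where s: "s \<in> carrier S" "tgt S y = src S s" "x = y \<star> s" "y \<in> carrier S"
    by (auto simp: R_le_def)
  from green_H_idempotent_right[OF s(4)] obtain f where
    f: "f \<in> carrier S" "src S f = tgt S y" "tgt S f = tgt S y" "J_le S f y" "y \<star> f = y"
    using green_H_refl[OF s(4)] by metis
  have "f \<in> I" using ideal_J_le[OF ideal _ f(4)] * by blast
  then have "f \<star> s \<in> I" using ideal f s by (auto simp: is_ideal_def)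
  moreover have "x = y \<star> (f \<star> s)" using s f by (metis mult_assoc)
  ultimately show "R_le (restrict_to S I) x y"
    using * f s by (auto simp: R_le_def src_mult intro!: bexI[of _ "f \<star> s"])
qed

lemma L_le_restrict: "L_le (restrict_to S I) x y \<longleftrightarrow> x \<in> I \<and> y \<in> I \<and> L_le S x y"
proof
  show "L_le (restrict_to S I) x y \<Longrightarrow> x \<in> I \<and> y \<in> I \<and> L_le S x y"
    by (auto simp: L_le_def ideal_carrier)
  assume *: "x \<in> I \<and> y \<in> I \<and> L_le S x y"
  then obtain s where s: "s \<in> carrier S" "tgt S s = src S y" "x = s \<star> y" "y \<in> carrier S"
    by (auto simp: L_le_def)
  from green_H_idempotent_left[OF s(4)] obtain f where
    f: "f \<in> carrier S" "src S f = src S y" "tgt S f = src S y" "J_le S f y" "f \<star> y = y"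
    using green_H_refl[OF s(4)] by metis
  have "f \<in> I" using ideal_J_le[OF ideal _ f(4)] * by blast
  then have "s \<star> f \<in> I" using ideal f s by (auto simp: is_ideal_def)
  moreover have "x = s \<star> f \<star> y" using s f by (metis mult_assoc)
  ultimately show "L_le (restrict_to S I) x y"
    using * f s by (auto simp: L_le_def tgt_mult intro!: bexI[of _ "s \<star> f"])
qed

text \<open>The product \<open>ayb\<close> is \<R>-below \<open>ay\<close>, which is \<L>-below
  \<open>y\<close>; since \<open>ay\<close> stays in the ideal, the one-sided cases combine.\<close>

lemma J_le_restrict: "J_le (restrict_to S I) x y \<longleftrightarrow> x \<in> I \<and> y \<in> I \<and> J_le S x y"
proof
  show "J_le (restrict_to S I) x y \<Longrightarrow> x \<in> I \<and> y \<in> I \<and> J_le S x y"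
    by (auto simp: J_le_def ideal_carrier intro!: bexI)
  assume *: "x \<in> I \<and> y \<in> I \<and> J_le S x y"
  then obtain a b where ab: "a \<in> carrier S" "b \<in> carrier S" "tgt S a = src S y" "tgt S y = src S b"
    "x = a \<star> y \<star> b" "y \<in> carrier S"
    by (auto simp: J_le_def)
  have y: "a \<star> y \<in> I" using ab * ideal by (auto simp: is_ideal_def)
  interpret T: regular_partial_semigroup "restrict_to S I" using ideal by (rule restrict_regular)
  have "R_le (restrict_to S I) x (a \<star> y)" using ab y * R_leI[of "a \<star> y" b] by (simp add: R_le_restrict mult_closed tgt_mult)
  moreover have "L_le (restrict_to S I) (a \<star> y) y" using ab y * by (simp add: L_le_restrict L_leI)
  ultimately show "J_le (restrict_to S I) x y"
    using T.J_le_trans T.R_le_imp_J_le T.L_le_imp_J_le by blast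
qed

lemma green_H_restrict: "green_H (restrict_to S I) = green_H S \<inter> I \<times> I"
proof -
  interpret T: regular_partial_semigroup "restrict_to S I" using ideal by (rule restrict_regular)
  show ?thesis by (auto simp: T.green_H_iff green_H_iff R_le_restrict L_le_restrict)
qed

lemma green_J_restrict: "green_J (restrict_to S I) = green_J S \<inter> I \<times> I"
proof -
  interpret T: regular_partial_semigroup "restrict_to S I" using ideal by (rule restrict_regular)
  show ?thesis by (auto simp: T.green_J_iff green_J_iff J_le_restrict)
qed

lemma J_class_restrict:
  assumes "J \<in> carrier S // green_J S" "J \<subseteq> I"
  shows "J \<in> I // green_J (restrict_to S I)"
proof -
  obtain x where x: "x \<in> carrier S" "J = green_J S `` {x}" using assms(1) by (auto simp: quotient_def)
  then have "x \<in> I" using assms(2) J_le_refl by (auto simp: green_J_iff)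
  then have "J = green_J (restrict_to S I) `` {x}"
    using x assms(2) by (auto simp: green_J_restrict)
  then show ?thesis using \<open>x \<in> I\<close> by (auto simp: quotient_def)
qed

lemma H_class_restrict:
  assumes "J \<in> carrier S // green_H S" "J \<subseteq> I"
  shows "J \<in> I // green_H (restrict_to S I)"
proof -
  obtain x where x: "x \<in> carrier S" "J = green_H S `` {x}" using assms(1) by (auto simp: quotient_def)
  then have "x \<in> I" using assms(2) green_H_refl by auto
  then have "J = green_H (restrict_to S I) `` {x}"
    using x assms(2) by (auto simp: green_H_restrict)
  then show ?thesis using \<open>x \<in> I\<close> by (auto simp: quotient_def)
qed

end

text \<open>By regularity, multiplying on both sides by elements of \<open>S\<close> rather than \<open>S\<^sup>1\<close> suffices here.\<close>

lemma
  shows zeta_eq: "zeta S = {(x, y) \<in> green_H S. \<forall>a \<in> carrier S. \<forall>b \<in> carrier S.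
     tgt S a = src S x \<longrightarrow> tgt S x = src S b \<longrightarrow> (a \<star> x \<star> b, a \<star> y \<star> b) \<in> green_H S}" (is "_ = ?Z")
    and zeta_Cong_H: "zeta S \<in> Cong_H S"
    and zeta_upper: "\<theta> \<in> Cong_H S \<Longrightarrow> \<theta> \<subseteq> zeta S"
proof -
  have ZI: "(x, y) \<in> ?Z" if "(x, y) \<in> green_H S" "\<And>a b. \<lbrakk>a \<in> carrier S; b \<in> carrier S; tgt S a = src S x;
      tgt S x = src S b\<rbrakk> \<Longrightarrow> (a \<star> x \<star> b, a \<star> y \<star> b) \<in> green_H S" for x y
    using that by blast
  have ZH: "(x, y) \<in> green_H S" if "(x, y) \<in> ?Z" for x y using that by blast
  have ZD: "(a \<star> x \<star> b, a \<star> y \<star> b) \<in> green_H S" if "(x, y) \<in> ?Z" "a \<in> carrier S" "b \<in> carrier S"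
    "tgt S a = src S x" "tgt S x = src S b" for x y a b using that by blast
  have "?Z \<in> Cong S"
  proof (rule CongI)
    fix x y assume xy: "(x, y) \<in> ?Z"
    note H = green_HD[OF ZH[OF xy]]
    have "(y, x) \<in> ?Z"
      using green_H_sym[OF ZH[OF xy]] green_H_sym[OF ZD[OF xy]] H by (intro ZI) auto
    then show "x \<in> carrier S \<and> parallel S x y \<and> (y, x) \<in> ?Z"
      using H by (simp add: parallel_def)
    fix s assume s: "s \<in> carrier S"
    { assume t: "tgt S x = src S s"
      show "(x \<star> s, y \<star> s) \<in> ?Z"
      proof (rule ZI)
        from green_H_idempotent_left[OF H(1)] obtain f where f: "f \<in> carrier S" "src S f = src S x"
          "tgt S f = src S x" "\<And>y. (x, y) \<in> green_H S \<Longrightarrow> f \<star> y = y" by blast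
        show "(x \<star> s, y \<star> s) \<in> green_H S"
          using ZD[OF xy f(1) s f(3) t] f(4)[OF green_H_refl[OF H(1)]] f(4)[OF ZH[OF xy]] by simp
        fix a b assume ab: "a \<in> carrier S" "b \<in> carrier S" "tgt S a = src S (x \<star> s)" "tgt S (x \<star> s) = src S b"
        show "(a \<star> (x \<star> s) \<star> b, a \<star> (y \<star> s) \<star> b) \<in> green_H S"
          using ZD[OF xy ab(1), of "s \<star> b"] ab s t H by (simp add: mult_simps)
      qed }
    { assume t: "tgt S s = src S x"
      show "(s \<star> x, s \<star> y) \<in> ?Z"
      proof (rule ZI)
        from green_H_idempotent_right[OF H(1)] obtain f where f: "f \<in> carrier S" "src S f = tgt S x"
          "tgt S f = tgt S x" "\<And>y. (x, y) \<in> green_H S \<Longrightarrow> y \<star> f = y" by blast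
        have "s \<star> x \<star> f = s \<star> x" "s \<star> y \<star> f = s \<star> y"
          using f(1-3) f(4)[OF green_H_refl[OF H(1)]] f(4)[OF ZH[OF xy]] H s t
          by (metis mult_assoc)+
        then show "(s \<star> x, s \<star> y) \<in> green_H S"
          using ZD[OF xy s f(1) t f(2)[symmetric]] by simp
        fix a b assume ab: "a \<in> carrier S" "b \<in> carrier S" "tgt S a = src S (s \<star> x)" "tgt S (s \<star> x) = src S b"
        show "(a \<star> (s \<star> x) \<star> b, a \<star> (s \<star> y) \<star> b) \<in> green_H S"
          using ZD[OF xy, of "a \<star> s" b] ab s t H by (simp add: mult_simps)
      qed }
  next
    fix x assume "x \<in> carrier S"
    then show "(x, x) \<in> ?Z"
      by (intro ZI green_H_refl) (simp_all add: mult_simps)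
  next
    fix x y z assume xy: "(x, y) \<in> ?Z" and yz: "(y, z) \<in> ?Z"
    note H = green_HD[OF ZH[OF xy]]
    show "(x, z) \<in> ?Z"
    proof (rule ZI)
      show "(x, z) \<in> green_H S" using green_H_trans ZH[OF xy] ZH[OF yz] by blast
      fix a b assume "a \<in> carrier S" "b \<in> carrier S" "tgt S a = src S x" "tgt S x = src S b"
      then show "(a \<star> x \<star> b, a \<star> z \<star> b) \<in> green_H S"
        using green_H_trans[OF ZD[OF xy] ZD[OF yz]] H by simp
    qed
  qed
  then have Z: "?Z \<in> Cong_H S" by (auto simp: Cong_H_def)
  \<comment> \<open>\<open>GREATEST\<close> denotes \<open>?Z\<close> only once \<open>?Z\<close>
    bounds every congruence inside \<H>. It does, because two-sided products of a pair of such a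
    congruence stay in it and hence in \<H>.\<close>
  have upper: "\<sigma> \<le> ?Z" if \<sigma>: "\<sigma> \<in> Cong_H S" for \<sigma>
  proof -
    have C: "\<sigma> \<in> Cong S" "\<sigma> \<subseteq> green_H S" using \<sigma> by (auto simp: Cong_H_def)
    show "\<sigma> \<le> ?Z"
    proof (intro subrelI)
      fix x y assume xy: "(x, y) \<in> \<sigma>"
      show "(x, y) \<in> ?Z"
      proof (rule ZI)
        show "(x, y) \<in> green_H S" using C xy by blast
        fix a b assume ab: "a \<in> carrier S" "b \<in> carrier S" "tgt S a = src S x" "tgt S x = src S b"
        have "(a \<star> x \<star> b, a \<star> y \<star> b) \<in> \<sigma>"
          using cong_mult_right[OF C(1) cong_mult_left[OF C(1) xy ab(1,3)] ab(2)] ab congD[OF C(1) xy]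
          by (simp add: tgt_mult)
        then show "(a \<star> x \<star> b, a \<star> y \<star> b) \<in> green_H S" using C by blast
      qed
    qed
  qed
  show eq: "zeta S = ?Z"
    unfolding zeta_def using Z upper by (rule Greatest_equality)
  show "zeta S \<in> Cong_H S" using Z eq by simp
  show "\<theta> \<in> Cong_H S \<Longrightarrow> \<theta> \<subseteq> zeta S" using upper eq by simp
qed

end

text \<open>The ideal tests fewer multipliers, so the inclusion of its \<zeta> in the large one is
  the point. With \<open>f\<close> and \<open>g\<close> the left and right identities of the
  \<H>-class of \<open>x\<close>, both in the ideal, \<open>axb = (af)x(gb)\<close> and
  \<open>ayb = (af)y(gb)\<close>, where \<open>af\<close> and \<open>gb\<close> are multipliers from
  the ideal. Hence (S3) for \<open>I s\<close> can be read with \<zeta> of \<open>U\<close>.\<close>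

lemma (in regular_partial_semigroup) zeta_restrict:
  assumes ideal: "is_ideal S I"
  shows "zeta (restrict_to S I) = zeta S \<inter> I \<times> I"
proof -
  interpret T: regular_partial_semigroup "restrict_to S I" using ideal by (rule restrict_regular)
  have C: "zeta S \<in> Cong S" "zeta S \<subseteq> green_H S" using zeta_Cong_H by (auto simp: Cong_H_def)
  have "zeta S \<inter> I \<times> I \<in> Cong_H (restrict_to S I)"
    using Cong_restrict[OF C(1) ideal] C(2) by (auto simp: Cong_H_def green_H_restrict[OF ideal])
  then have "zeta S \<inter> I \<times> I \<subseteq> zeta (restrict_to S I)" by (rule T.zeta_upper)
  moreover have "zeta (restrict_to S I) \<subseteq> zeta S \<inter> I \<times> I"
  proof (rule subrelI)
    fix x y assume xy: "(x, y) \<in> zeta (restrict_to S I)"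
    then have H: "(x, y) \<in> green_H S" and I: "x \<in> I" "y \<in> I"
      and Z: "\<And>a b. \<lbrakk>a \<in> I; b \<in> I; tgt S a = src S x; tgt S x = src S b\<rbrakk> \<Longrightarrow> (a \<star> x \<star> b, a \<star> y \<star> b) \<in> green_H S"
      unfolding T.zeta_eq by (auto simp: green_H_restrict[OF ideal])
    note HD = green_HD[OF H]
    have "(a \<star> x \<star> b, a \<star> y \<star> b) \<in> green_H S"
      if ab: "a \<in> carrier S" "b \<in> carrier S" "tgt S a = src S x" "tgt S x = src S b" for a b
    proof -
      from green_H_idempotent_left[OF HD(1)] obtain f where f: "f \<in> carrier S" "src S f = src S x"
        "tgt S f = src S x" "J_le S f x" "f \<star> x = x" "f \<star> y = y"
        using H green_H_refl[OF HD(1)] by metis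
      from green_H_idempotent_right[OF HD(1)] obtain g where g: "g \<in> carrier S" "src S g = tgt S x"
        "tgt S g = tgt S x" "J_le S g x" "x \<star> g = x" "y \<star> g = y"
        using H green_H_refl[OF HD(1)] by metis
      have fg: "f \<in> I" "g \<in> I" using ideal_J_le[OF ideal I(1)] f g by auto
      have afb: "a \<star> f \<in> I" "g \<star> b \<in> I"
        using ideal fg ab f g unfolding is_ideal_def by auto
      have "a \<star> x = (a \<star> f) \<star> x" "a \<star> y = (a \<star> f) \<star> y"
        using ab f HD by (simp_all add: mult_assoc)
      moreover have "a \<star> f \<star> x \<star> b = a \<star> f \<star> x \<star> (g \<star> b)" "a \<star> f \<star> y \<star> b = a \<star> f \<star> y \<star> (g \<star> b)"
        using ab f g HD mult_assoc[of "a \<star> f \<star> x" g b] mult_assoc[of "a \<star> f \<star> y" g b]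
          mult_assoc[of "a \<star> f" x g] mult_assoc[of "a \<star> f" y g]
        by (simp_all add: src_mult tgt_mult mult_closed)
      ultimately show ?thesis
        using Z[OF afb] ab f g HD by (simp add: tgt_mult src_mult)
    qed
    with H I show "(x, y) \<in> zeta S \<inter> I \<times> I" unfolding zeta_eq by blast
  qed
  ultimately show ?thesis by blast
qed

section \<open>Stability and group \<open>\<H>\<close>-classes\<close>

locale stable_partial_semigroup = regular_partial_semigroup +
  assumes stable: "J \<in> carrier S // green_J S \<Longrightarrow> stable_class S J"
begin

lemma stable_class_of:
  assumes "x \<in> carrier S"
  shows "stable_class S (green_J S `` {x})" "x \<in> green_J S `` {x}"
  using stable assms J_le_refl[OF assms] by (auto simp: quotient_def green_J_iff)

lemma stable_R:
  assumes "x \<in> carrier S" "a \<in> carrier S" "tgt S x = src S a" "J_le S x (x \<star> a)"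
  shows "R_le S x (x \<star> a)"
  using stable_class_of[OF assms(1)] assms J_le_mult(1)[OF assms(1-3)]
  unfolding stable_class_def by (auto simp: green_J_iff green_R_iff)

lemma stable_L:
  assumes "x \<in> carrier S" "a \<in> carrier S" "tgt S a = src S x" "J_le S x (a \<star> x)"
  shows "L_le S x (a \<star> x)"
  using stable_class_of[OF assms(1)] assms J_le_mult(2)[OF assms(1-3)]
  unfolding stable_class_def by (auto simp: green_J_iff green_L_iff)

lemma restrict_stable:
  assumes ideal: "is_ideal S I"
  shows "stable_partial_semigroup (restrict_to S I)"
proof -
  interpret T: regular_partial_semigroup "restrict_to S I" using ideal by (rule restrict_regular)
  show ?thesis
  proof
    fix J assume J: "J \<in> carrier (restrict_to S I) // green_J (restrict_to S I)"
    then have "J \<subseteq> I" by (auto simp: quotient_def green_J_def)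
    then show "stable_class (restrict_to S I) J"
      using ideal_carrier[OF ideal] stable_R stable_L
      unfolding stable_class_def T.green_J_iff T.green_R_iff T.green_L_iff
      by (auto simp: J_le_restrict[OF ideal] R_le_restrict[OF ideal] L_le_restrict[OF ideal] R_leI L_leI subset_iff)
  qed
qed

end

lemma H_group_simps [simp]: "carrier (H_group S G) = G" "mult (H_group S G) = pmult S"
  by (simp_all add: H_group_def)

lemma H_group_restrict [simp]: "H_group (restrict_to S I) G = H_group S G"
  by (simp add: H_group_def)

section \<open>A group \<H>-class inside a stable \<J>-class, and Green's lemma\<close>

locale group_class_in_J_class = stable_partial_semigroup +
  fixes D G
  assumes D_class: "D \<in> carrier S // green_J S"
    and G_class: "group_H_class S G"
    and G_sub_D: "G \<subseteq> D"
begin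

abbreviation e where "e \<equiv> \<one>\<^bsub>H_group S G\<^esub>"

sublocale grp: group "H_group S G"
  using G_class by (simp add: group_H_class_def)

lemma e_in: "e \<in> G"
  using grp.one_closed by simp

lemma G_mult: "x \<in> G \<Longrightarrow> y \<in> G \<Longrightarrow> x \<star> y \<in> G"
  using grp.m_closed[of x y] by simp

lemma e_left: "x \<in> G \<Longrightarrow> e \<star> x = x" and e_right: "x \<in> G \<Longrightarrow> x \<star> e = x"
  using grp.l_one[of x] grp.r_one[of x] by simp_all

lemma G_iff: "x \<in> G \<longleftrightarrow> (e, x) \<in> green_H S"
proof -
  obtain y where y: "G = green_H S `` {y}"
    using G_class by (auto simp: group_H_class_def quotient_def)
  then have "(y, e) \<in> green_H S" using e_in by simp
  then show ?thesis using y green_H_sym green_H_trans by blast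
qed

lemma tgt_e: "tgt S e = src S e"
  using G_class e_in by (auto simp: group_H_class_def)

lemma G_props:
  assumes "x \<in> G"
  shows "x \<in> carrier S" "src S x = src S e" "tgt S x = src S e"
  using green_HD[OF G_iff[THEN iffD1, OF assms]] tgt_e by simp_all

lemma D_iff: "u \<in> D \<longleftrightarrow> J_le S e u \<and> J_le S u e"
  using J_class_eq[OF D_class, of e] G_sub_D e_in by (auto simp: green_J_iff)

lemma D_carrier: "u \<in> D \<Longrightarrow> u \<in> carrier S"
  using D_iff J_leD by blast

lemma D_H_closed: "u \<in> D \<Longrightarrow> (u, v) \<in> green_H S \<Longrightarrow> v \<in> D"
  using green_H_imp_J J_class_eq[OF D_class] by blast

text \<open>\<open>v \<mapsto> c v s\<close> and \<open>g \<mapsto> c' g s'\<close> are the mutually inverse bijections of Green's lemma between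
  the \<open>\<H>\<close>-class of \<open>u\<close> and \<open>G\<close>, normalised so that \<open>u\<close> corresponds to the identity of \<open>G\<close>.\<close>

definition green_coords :: "'a \<Rightarrow> 'a \<Rightarrow> 'a \<Rightarrow> 'a \<Rightarrow> 'a \<Rightarrow> bool" where
  "green_coords u c s c' s' \<longleftrightarrow>
     {u, c, s, c', s'} \<subseteq> carrier S \<and>
     src S c = src S e \<and> tgt S c = src S u \<and> src S s = tgt S u \<and> tgt S s = src S e \<and>
     src S c' = src S u \<and> tgt S c' = src S e \<and> src S s' = src S e \<and> tgt S s' = tgt S u \<and>
     c \<star> u \<star> s = e \<and> (\<forall>v. (u, v) \<in> green_H S \<longrightarrow> c \<star> v \<star> s \<in> G \<and> c' \<star> (c \<star> v \<star> s) \<star> s' = v)"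

text \<open>As \<open>e\<close> and \<open>u\<close> are \<J>-related, \<open>e = cus\<close> for
  some \<open>c\<close> and \<open>s\<close>. Then \<open>u\<close>, \<open>cu\<close> and
  \<open>e\<close> are all \<J>-related, and stability upgrades this to \<open>u\<close> \<L>
  \<open>cu\<close> \<R> \<open>e\<close>. The multipliers witnessing these two relations,
  \<open>u = c'(cu)\<close> and \<open>cu = es'\<close>, are the ones that undo \<open>c\<close> and
  \<open>s\<close>.\<close>

lemma green_coords_exist:
  assumes "u \<in> D"
  obtains c s c' s' where "green_coords u c s c' s'"
proof -
  have u: "u \<in> carrier S" "J_le S e u" "J_le S u e" using assms D_iff D_carrier by auto
  then obtain c s where cs: "c \<in> carrier S" "s \<in> carrier S" "tgt S c = src S u" "tgt S u = src S s" "e = c \<star> u \<star> s"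
    by (auto simp: J_le_def)
  note e_eq = cs(5) and cs = cs(1-4)
  have "src S (c \<star> u \<star> s) = src S c" "tgt S (c \<star> u \<star> s) = tgt S s"
    using cs u by (simp_all add: src_mult tgt_mult mult_closed)
  then have st: "src S c = src S e" "tgt S s = src S e"
    using e_eq tgt_e by simp_all
  have cu: "c \<star> u \<in> carrier S" "tgt S (c \<star> u) = src S s" "tgt S (c \<star> u) = tgt S u" "src S (c \<star> u) = src S e"
    using cs u st by (simp_all add: mult_closed tgt_mult src_mult)
  have us: "u \<star> s \<in> carrier S" "src S (u \<star> s) = src S u"
    using cs u st by (simp_all add: mult_closed tgt_mult src_mult)
  have J: "J_le S e (c \<star> u)" "J_le S (c \<star> u) u"
    using J_le_mult(1)[OF cu(1) cs(2) cu(2)] J_le_mult(2)[OF u(1) cs(1,3)] by (simp_all add: e_eq[symmetric])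
  have "L_le S u (c \<star> u)"
    using stable_L[OF u(1) cs(1,3)] J_le_trans[OF u(3) J(1)] by blast
  then obtain c' where c': "c' \<in> carrier S" "tgt S c' = src S c" "u = c' \<star> (c \<star> u)"
    using cs u by (auto simp: L_le_def src_mult)
  note u_eq = c'(3) and c' = c'(1,2)
  have "R_le S (c \<star> u) e"
    using stable_R[OF cu(1) cs(2) cu(2)] J_le_trans[OF J(2) u(3)] by (simp add: e_eq[symmetric])
  then obtain s' where s': "s' \<in> carrier S" "src S s' = src S e" "c \<star> u = e \<star> s'"
    using tgt_e by (auto simp: R_le_def)
  note cu_eq = s'(3) and s' = s'(1,2)
  have st': "src S c' = src S u" "tgt S s' = tgt S u"
    using src_mult[of c' "c \<star> u"] tgt_mult[of e s'] c' s' cs cu st u_eq cu_eq G_props[OF e_in] by simp_all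
  \<comment> \<open>By choice \<open>s'\<close> undoes \<open>s\<close> on \<open>cu\<close>;
    multiplying by \<open>c'\<close> transfers this to \<open>u\<close>.\<close>
  have us': "u \<star> s \<star> s' = u"
  proof -
    have "u \<star> s = c' \<star> e"
      using u_eq e_eq mult_assoc[of c' "c \<star> u" s] c' cs u cu st by simp
    then have "u \<star> s \<star> s' = c' \<star> (e \<star> s')"
      using c' s' st G_props[OF e_in] by (simp add: mult_assoc)
    then show ?thesis by (simp add: cu_eq[symmetric] u_eq[symmetric])
  qed
  have main: "c \<star> v \<star> s \<in> G \<and> c' \<star> (c \<star> v \<star> s) \<star> s' = v" if H: "(u, v) \<in> green_H S" for v
  proof -
    note v = green_HD[OF H]
    have cv: "c \<star> v \<in> carrier S" "tgt S (c \<star> v) = src S s" "tgt S (c \<star> v) = tgt S u" "src S (c \<star> v) = src S e"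
      using cs v st by (simp_all add: mult_closed tgt_mult src_mult)
    have vs: "v \<star> s \<in> carrier S" "src S (v \<star> s) = src S u" "c \<star> v \<star> s = c \<star> (v \<star> s)"
      using cs v st by (simp_all add: mult_closed tgt_mult src_mult mult_assoc)
    \<comment> \<open>The form \<open>v = tu\<close> shows that \<open>s'\<close> undoes
      \<open>s\<close> on \<open>v\<close>, the form \<open>v = ut'\<close> that \<open>c'\<close>
      undoes \<open>c\<close> on \<open>v\<close>.\<close>
    obtain t where t: "t \<in> carrier S" "tgt S t = src S u" "v = t \<star> u"
      using H unfolding green_H_iff L_le_def by blast
    obtain t' where t': "t' \<in> carrier S" "src S t' = tgt S u" "v = u \<star> t'"
      using H unfolding green_H_iff R_le_def by metis
    have "t \<star> (u \<star> s \<star> s') = t \<star> u \<star> s \<star> s'"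
      using t cs s' u st by (simp add: mult_simps)
    then have vss: "v \<star> s \<star> s' = v" using us' t by simp
    have "c' \<star> (c \<star> u) \<star> t' = c' \<star> (c \<star> (u \<star> t'))"
      using t' cs c' u st by (simp add: mult_simps)
    then have ccv: "c' \<star> (c \<star> v) = v" using t' by (simp add: u_eq[symmetric])
    have "c' \<star> (c \<star> v \<star> s) \<star> s' = c' \<star> (c \<star> v) \<star> s \<star> s'"
      using v c' s' cs st by (simp add: mult_simps)
    then have inv: "c' \<star> (c \<star> v \<star> s) \<star> s' = v" using ccv vss by simp
    have "c \<star> v \<star> s \<star> s' = c \<star> (v \<star> s \<star> s')"
      using v cs s' st by (simp add: mult_simps)
    then have cvss: "c \<star> v \<star> s \<star> s' = c \<star> v" using vss by simp
    have "c' \<star> (c \<star> (v \<star> s)) = c' \<star> (c \<star> v) \<star> s"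
      using v cs c' st by (simp add: mult_simps)
    then have ccvs: "c' \<star> (c \<star> (v \<star> s)) = v \<star> s" using ccv by simp
    have cvs_in: "c \<star> v \<star> s \<in> carrier S" "tgt S (c \<star> v \<star> s) = src S e" "src S (c \<star> v \<star> s) = src S e"
      using v cs st by (simp_all add: mult_simps)
    have "R_le S (c \<star> v) (c \<star> v \<star> s)"
      using R_leI[of "c \<star> v \<star> s" s'] cvs_in s' cvss by simp
    moreover have "R_le S (c \<star> v \<star> s) (c \<star> v)" using R_leI cv cs by simp
    moreover have "R_le S e (c \<star> u)" "R_le S (c \<star> u) e"
      using R_leI[of "c \<star> u" s] cu cs \<open>R_le S (c \<star> u) e\<close> by (simp_all add: e_eq[symmetric])
    moreover have "R_le S (c \<star> u) (c \<star> v)" "R_le S (c \<star> v) (c \<star> u)"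
      using H R_le_mult cs v unfolding green_H_iff by simp_all
    ultimately have R: "R_le S e (c \<star> v \<star> s)" "R_le S (c \<star> v \<star> s) e"
      using R_le_trans by blast+
    have "L_le S (v \<star> s) (c \<star> v \<star> s)"
      using L_leI[of "c \<star> (v \<star> s)" c'] cvs_in c' ccvs vs st by simp
    moreover have "L_le S (c \<star> v \<star> s) (v \<star> s)" using L_leI vs cs by simp
    moreover have "L_le S (u \<star> s) e"
      using L_leI[of e c'] u_eq e_eq mult_assoc[of c' "c \<star> u" s] c' cs u cu st G_props[OF e_in] by simp
    moreover have "L_le S e (u \<star> s)"
      using L_leI[of "u \<star> s" c] us cs u by (simp add: mult_assoc e_eq)
    moreover have "L_le S (u \<star> s) (v \<star> s)" "L_le S (v \<star> s) (u \<star> s)"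
      using H L_le_mult cs v unfolding green_H_iff by simp_all
    ultimately have L: "L_le S e (c \<star> v \<star> s)" "L_le S (c \<star> v \<star> s) e"
      using L_le_trans by blast+
    show ?thesis using R L inv G_iff green_H_iff by blast
  qed
  have "green_coords u c s c' s'"
    unfolding green_coords_def using u(1) cs st c' s' st' main e_eq by simp
  then show ?thesis by (rule that)
qed

section \<open>The relation \<open>\<nu>\<^sub>N\<close> in coordinates\<close>

lemma adjoin_left:
  assumes "a \<in> carrier (adjoin_ids S)" "tgt (adjoin_ids S) a = src S e"
  obtains a' where "a' \<in> carrier S" "tgt S a' = src S e"
    "\<And>x. x \<in> G \<Longrightarrow> a \<star>\<^bsub>adjoin_ids S\<^esub> Inl x = Inl (a' \<star> x)"
proof (cases a)
  case (Inl a')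
  then show ?thesis using assms that[of a'] by (auto simp: adjoin_ids_def)
next
  case (Inr c)
  then show ?thesis
    using assms that[of e] G_props[OF e_in] by (auto simp: adjoin_ids_def e_left)
qed

text \<open>Stated for all \<open>z\<close> with \<open>ze = z\<close>, since it is applied to
  products \<open>a'x\<close> that need not lie in \<open>G\<close>.\<close>

lemma adjoin_right:
  assumes "b \<in> carrier (adjoin_ids S)" "src (adjoin_ids S) b = src S e"
  obtains b' where "b' \<in> carrier S" "src S b' = src S e"
    "\<And>z. z \<star> e = z \<Longrightarrow> Inl z \<star>\<^bsub>adjoin_ids S\<^esub> b = Inl (z \<star> b')"
proof (cases b)
  case (Inl b')
  then show ?thesis using assms that[of b'] by (auto simp: adjoin_ids_def)
next
  case (Inr c)
  then show ?thesis
    using assms that[of e] G_props[OF e_in] by (auto simp: adjoin_ids_def)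
qed

text \<open>Next to an element of \<open>G\<close> an adjoined identity acts like \<open>e\<close>,
  so both multipliers can be taken in \<open>S\<close>.\<close>

lemma nu_iff:
  assumes "N \<subseteq> G"
  shows "(u, v) \<in> nu S D N \<longleftrightarrow> u \<in> D \<and> v \<in> D \<and>
    (\<exists>x \<in> N. \<exists>y \<in> N. \<exists>a \<in> carrier S. \<exists>b \<in> carrier S.
       tgt S a = src S e \<and> src S b = src S e \<and> u = a \<star> x \<star> b \<and> v = a \<star> y \<star> b)" (is "_ \<longleftrightarrow> ?R")
proof
  assume "(u, v) \<in> nu S D N"
  then obtain x y a b where *: "u \<in> D" "v \<in> D" "x \<in> N" "y \<in> N"
    "a \<in> carrier (adjoin_ids S)" "b \<in> carrier (adjoin_ids S)"
    "tgt (adjoin_ids S) a = src (adjoin_ids S) (Inl x)"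
    "tgt (adjoin_ids S) (Inl x) = src (adjoin_ids S) b"
    "Inl u = a \<star>\<^bsub>adjoin_ids S\<^esub> Inl x \<star>\<^bsub>adjoin_ids S\<^esub> b"
    "Inl v = a \<star>\<^bsub>adjoin_ids S\<^esub> Inl y \<star>\<^bsub>adjoin_ids S\<^esub> b"
    unfolding nu_def by blast
  have xy: "x \<in> G" "y \<in> G" using * assms by auto
  have "src (adjoin_ids S) (Inl x) = src S e" "tgt (adjoin_ids S) (Inl x) = src S e"
    using G_props[OF xy(1)] by (simp_all add: adjoin_ids_def)
  then have t: "tgt (adjoin_ids S) a = src S e" "src (adjoin_ids S) b = src S e"
    using * by simp_all
  obtain a' where a': "a' \<in> carrier S" "tgt S a' = src S e"
    "\<And>x. x \<in> G \<Longrightarrow> a \<star>\<^bsub>adjoin_ids S\<^esub> Inl x = Inl (a' \<star> x)"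
    using adjoin_left[OF *(5) t(1)] by blast
  obtain b' where b': "b' \<in> carrier S" "src S b' = src S e"
    "\<And>z. z \<star> e = z \<Longrightarrow> Inl z \<star>\<^bsub>adjoin_ids S\<^esub> b = Inl (z \<star> b')"
    using adjoin_right[OF *(6) t(2)] by blast
  have "a' \<star> x \<star> e = a' \<star> x" "a' \<star> y \<star> e = a' \<star> y"
    using a' xy G_props[of x] G_props[of y] G_props[OF e_in] by (simp_all add: mult_assoc e_right)
  then have "u = a' \<star> x \<star> b'" "v = a' \<star> y \<star> b'"
    using *(9,10) a' b' xy by simp_all
  then show ?R using * a' b' by blast
next
  assume ?R
  then obtain x y a b where *: "u \<in> D" "v \<in> D" "x \<in> N" "y \<in> N" "a \<in> carrier S" "b \<in> carrier S"
    "tgt S a = src S e" "src S b = src S e" "u = a \<star> x \<star> b" "v = a \<star> y \<star> b"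
    by blast
  have "src S x = src S e" "tgt S x = src S e" "src S y = src S e" "tgt S y = src S e"
    using * assms G_props by auto
  then have "\<exists>a\<in>carrier (adjoin_ids S). \<exists>b\<in>carrier (adjoin_ids S).
        tgt (adjoin_ids S) a = src (adjoin_ids S) (Inl x) \<and>
        tgt (adjoin_ids S) (Inl x) = src (adjoin_ids S) b \<and>
        tgt (adjoin_ids S) a = src (adjoin_ids S) (Inl y) \<and>
        tgt (adjoin_ids S) (Inl y) = src (adjoin_ids S) b \<and>
        Inl u = a \<star>\<^bsub>adjoin_ids S\<^esub> Inl x \<star>\<^bsub>adjoin_ids S\<^esub> b \<and>
        Inl v = a \<star>\<^bsub>adjoin_ids S\<^esub> Inl y \<star>\<^bsub>adjoin_ids S\<^esub> b"
    using * by (intro bexI[of _ "Inl a"] bexI[of _ "Inl b"]) (simp_all add: adjoin_ids_def)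
  then show "(u, v) \<in> nu S D N"
    using * unfolding nu_def by blast
qed

text \<open>All elements of \<open>G\<close> are \<H>-related, and left multiplication preserves
  \<R>, so \<open>ax\<close> \<R> \<open>ay\<close>. Because \<open>axb\<close> and
  \<open>ayb\<close> are still in \<open>D\<close>, stability gives \<open>ax\<close> \<R>
  \<open>axb\<close> and \<open>ay\<close> \<R> \<open>ayb\<close>, hence \<open>u\<close> \<R>
  \<open>v\<close>; the argument for \<L> is dual.\<close>

lemma nu_sub_H:
  assumes "N \<subseteq> G"
  shows "nu S D N \<subseteq> green_H S"
proof (rule subrelI)
  fix u v assume "(u, v) \<in> nu S D N"
  then obtain x y a b where *: "u \<in> D" "v \<in> D" "x \<in> N" "y \<in> N" "a \<in> carrier S" "b \<in> carrier S"
    "tgt S a = src S e" "src S b = src S e" "u = a \<star> x \<star> b" "v = a \<star> y \<star> b"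
    unfolding nu_iff[OF assms] by blast
  have xy: "x \<in> G" "y \<in> G" using * assms by auto
  then have H: "(x, y) \<in> green_H S" using G_iff green_H_sym green_H_trans by blast
  have key: "R_le S (a \<star> z) (a \<star> z \<star> b) \<and> L_le S (z \<star> b) (a \<star> z \<star> b)"
    if z: "z \<in> G" "a \<star> z \<star> b \<in> D" for z
  proof -
    note zp = G_props[OF z(1)]
    have Je: "J_le S e (a \<star> z \<star> b)" "J_le S z e"
      using z D_iff G_sub_D by auto
    have "J_le S (a \<star> z) z" "J_le S (z \<star> b) z"
      using J_le_mult zp * by simp_all
    then have "J_le S (a \<star> z) (a \<star> z \<star> b)" "J_le S (z \<star> b) (a \<star> z \<star> b)"
      using Je J_le_trans by blast+
    then show ?thesis
      using stable_R[of "a \<star> z" b] stable_L[of "z \<star> b" a] zp *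
      by (simp add: src_mult tgt_mult mult_closed mult_assoc)
  qed
  have R: "R_le S (a \<star> z \<star> b) (a \<star> z)" and L: "L_le S (a \<star> z \<star> b) (z \<star> b)" if "z \<in> G" for z
    using R_leI[of "a \<star> z" b] L_leI[of "z \<star> b" a] G_props[OF that] *
    by (simp_all add: src_mult tgt_mult mult_closed mult_assoc)
  have R2: "R_le S (a \<star> x) (a \<star> y)" "R_le S (a \<star> y) (a \<star> x)"
    and L2: "L_le S (x \<star> b) (y \<star> b)" "L_le S (y \<star> b) (x \<star> b)"
    using H R_le_mult L_le_mult * G_props[OF xy(1)] G_props[OF xy(2)] unfolding green_H_iff by simp_all
  have "R_le S u v" "R_le S v u" "L_le S u v" "L_le S v u"
    using R[OF xy(1)] R[OF xy(2)] L[OF xy(1)] L[OF xy(2)] R2 L2 key[OF xy(1)] key[OF xy(2)] *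
    by (metis R_le_trans L_le_trans)+
  then show "(u, v) \<in> green_H S" by (simp add: green_H_iff)
qed

lemma green_coordsD:
  assumes "green_coords u c s c' s'"
  shows "u \<in> carrier S" "c \<in> carrier S" "s \<in> carrier S" "c' \<in> carrier S" "s' \<in> carrier S"
    "src S c = src S e" "tgt S c = src S u" "src S s = tgt S u" "tgt S s = src S e"
    "src S c' = src S u" "tgt S c' = src S e" "src S s' = src S e" "tgt S s' = tgt S u"
    "c \<star> u \<star> s = e"
    "(u, v) \<in> green_H S \<Longrightarrow> c \<star> v \<star> s \<in> G"
    "(u, v) \<in> green_H S \<Longrightarrow> c' \<star> (c \<star> v \<star> s) \<star> s' = v"
  using assms unfolding green_coords_def by auto

text \<open>If \<open>c v s = p x q\<close> lies in \<open>G\<close> with \<open>x \<in> G\<close>, then stability forces \<open>p, q \<in> G\<close>; hence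
  \<open>c w s = p y q\<close> differs from \<open>c v s\<close> by a conjugate of \<open>x\<^sup>-\<^sup>1 y\<close>.\<close>

lemma nu_coords_step:
  assumes N: "N \<lhd> H_group S G" and co: "green_coords u c s c' s'"
    and uv: "(u, v) \<in> green_H S" and vw: "(v, w) \<in> nu S D N" and in_N: "c \<star> v \<star> s \<in> N"
  shows "c \<star> w \<star> s \<in> N"
proof -
  interpret N: normal N "H_group S G" by (rule N)
  have NG: "N \<subseteq> G" using N.subset by simp
  obtain x y a b where *: "x \<in> N" "y \<in> N" "a \<in> carrier S" "b \<in> carrier S"
    "tgt S a = src S e" "src S b = src S e" "v = a \<star> x \<star> b" "w = a \<star> y \<star> b"
    using vw unfolding nu_iff[OF NG] by blast
  have xy: "x \<in> G" "y \<in> G" using * NG by auto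
  note cd = green_coordsD[OF co]
  note ep = G_props[OF e_in]
  have st: "src S a = src S u" "tgt S b = tgt S u"
    using green_HD[OF uv] * G_props[OF xy(1)] by (simp_all add: mult_simps)
  \<comment> \<open>The factors \<open>e\<close> put \<open>p\<close> \<L>-below and
    \<open>q\<close> \<R>-below \<open>e\<close>, so that both are \<J>-below
    \<open>c \<star> v \<star> s\<close> and stability applies. They do not change the products,
    because \<open>eze = z\<close> for \<open>z\<close> in \<open>G\<close>.\<close>
  define p where "p = c \<star> a \<star> e"
  define q where "q = e \<star> b \<star> s"
  have pS: "p \<in> carrier S" "src S p = src S e" "tgt S p = src S e"
    and qS: "q \<in> carrier S" "src S q = src S e" "tgt S q = src S e"
    using * cd(1-13) ep st by (simp_all add: p_def q_def mult_simps)
  have pq: "p \<star> z \<star> q = c \<star> (a \<star> z \<star> b) \<star> s" if "z \<in> G" for z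
  proof -
    have "p \<star> z \<star> q = c \<star> a \<star> (e \<star> z) \<star> (e \<star> b \<star> s)"
      using *(3-6) cd(1-13) ep st G_props[OF that] by (simp add: p_def q_def mult_simps)
    also have "\<dots> = c \<star> a \<star> (z \<star> e) \<star> (b \<star> s)"
      using *(3-6) cd(1-13) ep st G_props[OF that] e_left[OF that] by (simp add: mult_simps)
    also have "\<dots> = c \<star> (a \<star> z \<star> b) \<star> s"
      using *(3-6) cd(1-13) ep st G_props[OF that] e_right[OF that] by (simp add: mult_simps)
    finally show ?thesis .
  qed
  define g where "g = c \<star> v \<star> s"
  have g: "g \<in> G" "p \<star> x \<star> q = g" using in_N NG pq[OF xy(1)] * by (auto simp: g_def)
  note gp = G_props[OF g(1)] and xp = G_props[OF xy(1)]
  have gH: "R_le S e g" "R_le S g e" "L_le S e g" "L_le S g e"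
    using g G_iff green_H_iff by auto
  have p_in: "p \<in> G"
  proof -
    have ca: "c \<star> a \<in> carrier S" "tgt S (c \<star> a) = src S e"
      using cd(1-13) * st by (simp_all add: mult_simps)
    have Lpe: "L_le S p e" unfolding p_def using L_leI[of e "c \<star> a"] ca ep by simp
    have "R_le S g p" using R_leI[of p "x \<star> q"] pS qS xp g(2)[symmetric] by (simp add: mult_simps)
    then have Rep: "R_le S e p" using gH R_le_trans by blast
    have Lep: "L_le S e p" using stable_L[of e "c \<star> a"] ca ep R_le_imp_J_le[OF Rep] by (simp add: p_def)
    have "p \<star> (x \<star> q) = g" using g(2) pS qS xp by (simp add: mult_simps)
    moreover have "J_le S p g" using L_le_imp_J_le[OF Lpe] R_le_imp_J_le[OF gH(1)] J_le_trans by blast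
    ultimately have "R_le S p g" using stable_R[of p "x \<star> q"] pS qS xp by (simp add: mult_simps)
    then have "R_le S p e" using gH R_le_trans by blast
    then show ?thesis using Lpe Lep Rep G_iff green_H_iff by blast
  qed
  have q_in: "q \<in> G"
  proof -
    have bs: "b \<star> s \<in> carrier S" "src S (b \<star> s) = src S e" "q = e \<star> (b \<star> s)"
      using cd(1-13) * st ep by (simp_all add: q_def mult_simps)
    have Rqe: "R_le S q e" unfolding bs(3) using R_leI[of e "b \<star> s"] bs(1,2) ep by simp
    have "L_le S g q" using L_leI[of q "p \<star> x"] pS qS xp g(2)[symmetric] by (simp add: mult_simps)
    then have Leq: "L_le S e q" using gH L_le_trans by blast
    have Req: "R_le S e q" using stable_R[of e "b \<star> s"] bs ep L_le_imp_J_le[OF Leq] by simp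
    have "p \<star> x \<star> q = g" by (rule g(2))
    moreover have "J_le S q g" using R_le_imp_J_le[OF Rqe] R_le_imp_J_le[OF gH(1)] J_le_trans by blast
    ultimately have "L_le S q g" using stable_L[of q "p \<star> x"] pS qS xp by (simp add: src_mult tgt_mult mult_closed)
    then have "L_le S q e" using gH L_le_trans by blast
    then show ?thesis using Rqe Req Leq G_iff green_H_iff by blast
  qed
  let ?H = "H_group S G"
  have in_H: "p \<in> carrier ?H" "q \<in> carrier ?H" "x \<in> carrier ?H" "y \<in> carrier ?H"
    using p_in q_in xy by simp_all
  have cancel: "a \<otimes>\<^bsub>?H\<^esub> (inv\<^bsub>?H\<^esub> a \<otimes>\<^bsub>?H\<^esub> b) = b" if "a \<in> carrier ?H" "b \<in> carrier ?H" for a b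
    using that grp.m_assoc[of a "inv\<^bsub>?H\<^esub> a" b] by (simp del: H_group_simps)
  have "(p \<otimes>\<^bsub>?H\<^esub> x \<otimes>\<^bsub>?H\<^esub> q) \<otimes>\<^bsub>?H\<^esub> (inv\<^bsub>?H\<^esub> q \<otimes>\<^bsub>?H\<^esub> (inv\<^bsub>?H\<^esub> x \<otimes>\<^bsub>?H\<^esub> y) \<otimes>\<^bsub>?H\<^esub> q) \<in> N"
    using N.m_closed[OF _ N.inv_op_closed1[OF _ N.m_closed[OF N.m_inv_closed[OF *(1)] *(2)]]]
      g(2) in_N q_in by (simp add: g_def)
  also have "(p \<otimes>\<^bsub>?H\<^esub> x \<otimes>\<^bsub>?H\<^esub> q) \<otimes>\<^bsub>?H\<^esub> (inv\<^bsub>?H\<^esub> q \<otimes>\<^bsub>?H\<^esub> (inv\<^bsub>?H\<^esub> x \<otimes>\<^bsub>?H\<^esub> y) \<otimes>\<^bsub>?H\<^esub> q) = p \<otimes>\<^bsub>?H\<^esub> y \<otimes>\<^bsub>?H\<^esub> q"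
    using in_H cancel by (simp del: H_group_simps add: grp.m_assoc)
  finally show ?thesis using pq[OF xy(2)] * by simp
qed

text \<open>Starting \<open>nu_coords_step\<close> at \<open>v = u\<close>, whose coordinate is
  \<open>e\<close>, shows that in coordinates centred at \<open>u\<close> the \<nu>-class of
  \<open>u\<close> becomes exactly \<open>N\<close>. The unknown multipliers in \<open>nu\<close>
  are thereby replaced by fixed ones.\<close>

lemma nu_coords_iff:
  assumes N: "N \<lhd> H_group S G" and u: "u \<in> D" and co: "green_coords u c s c' s'"
  shows "(u, v) \<in> nu S D N \<longleftrightarrow> (u, v) \<in> green_H S \<and> c \<star> v \<star> s \<in> N"
proof
  interpret N: normal N "H_group S G" by (rule N)
  have NG: "N \<subseteq> G" using N.subset by simp
  note cd = green_coordsD[OF co]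
  have eN: "e \<in> N" using N.one_closed .
  { assume uv: "(u, v) \<in> nu S D N"
    then show "(u, v) \<in> green_H S \<and> c \<star> v \<star> s \<in> N"
      using nu_sub_H[OF NG] nu_coords_step[OF N co green_H_refl[OF cd(1)] uv] cd(14) eN by auto }
  { assume "(u, v) \<in> green_H S \<and> c \<star> v \<star> s \<in> N"
    moreover from this have "v \<in> D" using D_H_closed u by blast
    moreover have "u = c' \<star> e \<star> s'" using cd(14) cd(16)[OF green_H_refl[OF cd(1)]] by simp
    moreover have "v = c' \<star> (c \<star> v \<star> s) \<star> s'" using cd(16) calculation by simp
    ultimately show "(u, v) \<in> nu S D N"
      unfolding nu_iff[OF NG] using u eN cd(4,5,11,12) by blast }
qed

lemma nu_sym: "N \<subseteq> G \<Longrightarrow> (u, v) \<in> nu S D N \<Longrightarrow> (v, u) \<in> nu S D N"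
  by (auto simp: nu_iff)

text \<open>The two pairs may come from different multipliers \<open>a\<close>, \<open>b\<close>, so
  the defining representations do not compose. In coordinates at \<open>u\<close> both steps stay in
  \<open>N\<close>.\<close>

lemma nu_trans:
  assumes N: "N \<lhd> H_group S G" and uv: "(u, v) \<in> nu S D N" and vw: "(v, w) \<in> nu S D N"
  shows "(u, w) \<in> nu S D N"
proof -
  interpret N: normal N "H_group S G" by (rule N)
  have NG: "N \<subseteq> G" using N.subset by simp
  have u: "u \<in> D" using uv nu_iff[OF NG] by blast
  then obtain c s c' s' where co: "green_coords u c s c' s'" using green_coords_exist by blast
  have "(u, v) \<in> green_H S" "c \<star> v \<star> s \<in> N" "(v, w) \<in> green_H S"
    using uv vw nu_coords_iff[OF N u co] nu_sub_H[OF NG] by auto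
  then show ?thesis
    using nu_coords_step[OF N co _ vw] nu_coords_iff[OF N u co] green_H_trans by blast
qed

lemma nu_refl:
  assumes N: "N \<lhd> H_group S G" and u: "u \<in> D"
  shows "(u, u) \<in> nu S D N"
proof -
  interpret N: normal N "H_group S G" by (rule N)
  obtain c s c' s' where co: "green_coords u c s c' s'" using green_coords_exist[OF u] by blast
  then show ?thesis
    using nu_coords_iff[OF N u co] green_coordsD(14)[OF co] N.one_closed green_H_refl D_carrier[OF u] by simp
qed

text \<open>The coordinates at \<open>e\<close> can all be chosen to be \<open>e\<close>. Thus
  \<open>nu\<close> determines \<open>N\<close>, which is the source of the uniqueness of
  NZ-tuples.\<close>

lemma nu_e_iff:
  assumes N: "N \<lhd> H_group S G"
  shows "(e, g) \<in> nu S D N \<longleftrightarrow> g \<in> N"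
proof -
  interpret N: normal N "H_group S G" by (rule N)
  have NG: "N \<subseteq> G" using N.subset by simp
  have eg: "e \<star> v \<star> e = v" if "v \<in> G" for v using that by (simp add: e_left e_right)
  have co: "green_coords e e e e e"
    unfolding green_coords_def using G_props[OF e_in] eg e_in G_iff by auto
  have "e \<in> D" using G_sub_D e_in by blast
  then have "(e, g) \<in> nu S D N \<longleftrightarrow> g \<in> G \<and> e \<star> g \<star> e \<in> N"
    using nu_coords_iff[OF N _ co, of g] G_iff by simp
  then show ?thesis using NG eg by auto
qed

section \<open>Congruences restricted to one \<J>-class\<close>

lemma cong_coords:
  assumes "\<tau> \<in> Cong S" "(u, v) \<in> \<tau>" and co: "green_coords u c s c' s'"
  shows "(e, c \<star> v \<star> s) \<in> \<tau>"
  using cong_mult_right[OF assms(1) cong_mult_left[OF assms(1,2)], of c s] green_coordsD[OF co]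
  by (simp add: tgt_mult mult_closed)

lemma cong_normal:
  assumes \<tau>: "\<tau> \<in> Cong S"
  shows "{g \<in> G. (e, g) \<in> \<tau>} \<lhd> H_group S G"
proof -
  let ?N = "{g \<in> G. (e, g) \<in> \<tau>}"
  let ?H = "H_group S G"
  have L: "(x \<star> y, x \<star> z) \<in> \<tau>" and R: "(y \<star> x, z \<star> x) \<in> \<tau>"
    if "x \<in> G" "y \<in> G" "z \<in> G" "(y, z) \<in> \<tau>" for x y z
    using cong_mult_left[OF \<tau> that(4)] cong_mult_right[OF \<tau> that(4)] G_props that by auto
  have inv_in: "inv\<^bsub>?H\<^esub> x \<in> G" if "x \<in> G" for x using grp.inv_closed[of x] that by simp
  have inv_m: "x \<star> inv\<^bsub>?H\<^esub> x = e" "inv\<^bsub>?H\<^esub> x \<star> x = e" if "x \<in> G" for x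
    using grp.r_inv[of x] grp.l_inv[of x] that by simp_all
  have "subgroup ?N ?H"
  proof (rule grp.subgroupI)
    show "?N \<subseteq> carrier ?H" by auto
    show "?N \<noteq> {}" using e_in cong_refl[OF \<tau>] G_props(1) by auto
    fix a assume "a \<in> ?N"
    then have a: "a \<in> G" "(e, a) \<in> \<tau>" by auto
    have "(inv\<^bsub>?H\<^esub> a \<star> e, inv\<^bsub>?H\<^esub> a \<star> a) \<in> \<tau>" using L[OF inv_in[OF a(1)] e_in a] .
    then show "inv\<^bsub>?H\<^esub> a \<in> ?N"
      using inv_m(2)[OF a(1)] e_right[OF inv_in[OF a(1)]] congD(5)[OF \<tau>] inv_in[OF a(1)] by auto
    fix b assume "b \<in> ?N"
    then have b: "b \<in> G" "(e, b) \<in> \<tau>" by auto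
    have "(a \<star> e, a \<star> b) \<in> \<tau>" using L[OF a(1) e_in b] .
    then show "a \<otimes>\<^bsub>?H\<^esub> b \<in> ?N"
      using a b e_right[OF a(1)] cong_trans[OF \<tau> a(2)] G_mult by simp
  qed
  moreover have "x \<otimes>\<^bsub>?H\<^esub> h \<otimes>\<^bsub>?H\<^esub> inv\<^bsub>?H\<^esub> x \<in> ?N" if "x \<in> carrier ?H" "h \<in> ?N" for x h
  proof -
    have x: "x \<in> G" and h: "h \<in> G" "(e, h) \<in> \<tau>" using that by auto
    have "(x \<star> e \<star> inv\<^bsub>?H\<^esub> x, x \<star> h \<star> inv\<^bsub>?H\<^esub> x) \<in> \<tau>"
      using R[OF inv_in[OF x] _ _ L[OF x e_in h]] G_mult x h e_in by simp
    then show ?thesis using x h inv_m[OF x] e_right[OF x] G_mult inv_in[OF x] by simp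
  qed
  ultimately show ?thesis using grp.normal_inv_iff by blast
qed

text \<open>Green's coordinates move a pair \<open>(u, v)\<close> of \<tau> to
  \<open>(e, cvs)\<close>, and multiplication moves pairs near \<open>e\<close> back. Only the part
  of \<tau> on \<open>D\<close> is assumed to lie in \<H>, because in (ii) a congruence can be
  universal below \<open>D\<close> and still be controlled on \<open>D\<close>.\<close>

lemma cong_class_eq_nu:
  assumes \<tau>: "\<tau> \<in> Cong S" and sub: "\<tau> \<inter> D \<times> D \<subseteq> green_H S"
  shows "\<tau> \<inter> D \<times> D = nu S D {g \<in> G. (e, g) \<in> \<tau>}"
proof -
  let ?N = "{g \<in> G. (e, g) \<in> \<tau>}"
  note N = cong_normal[OF \<tau>]
  have "(u, v) \<in> \<tau> \<inter> D \<times> D \<longleftrightarrow> (u, v) \<in> nu S D ?N" for u v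
  proof
    assume uv: "(u, v) \<in> \<tau> \<inter> D \<times> D"
    then have u: "u \<in> D" and H: "(u, v) \<in> green_H S" using sub by auto
    from green_coords_exist[OF u] obtain c s c' s' where co: "green_coords u c s c' s'" .
    show "(u, v) \<in> nu S D ?N"
      using nu_coords_iff[OF N u co] cong_coords[OF \<tau> _ co] uv H green_coordsD(15)[OF co] by simp
  next
    assume "(u, v) \<in> nu S D ?N"
    then obtain x y a b where *: "u \<in> D" "v \<in> D" "x \<in> ?N" "y \<in> ?N" "a \<in> carrier S" "b \<in> carrier S"
      "tgt S a = src S e" "src S b = src S e" "u = a \<star> x \<star> b" "v = a \<star> y \<star> b"
      using nu_iff[of ?N] by blast
    then have xy: "(x, y) \<in> \<tau>" using cong_trans[OF \<tau>] congD(5)[OF \<tau>] by blast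
    have xp: "x \<in> carrier S" "src S x = src S e" "tgt S x = src S e" using * G_props by auto
    have "(a \<star> x \<star> b, a \<star> y \<star> b) \<in> \<tau>"
      using cong_mult_right[OF \<tau> cong_mult_left[OF \<tau> xy], of a b] xp * by (simp add: tgt_mult)
    then show "(u, v) \<in> \<tau> \<inter> D \<times> D" using * by simp
  qed
  then show ?thesis by auto
qed

text \<open>The \<J>-relation covers the case that the product leaves \<open>D\<close>: both
  products drop together, so in a Rees-type congruence they land in the universal part at the same
  time.\<close>

lemma nu_mult_right:
  assumes NG: "N \<subseteq> G" and uv: "(u, v) \<in> nu S D N" and s: "s \<in> carrier S" "tgt S u = src S s"
  shows "(u \<star> s, v \<star> s) \<in> green_J S" and "u \<star> s \<in> D \<Longrightarrow> (u \<star> s, v \<star> s) \<in> nu S D N"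
proof -
  have H: "(u, v) \<in> green_H S" using nu_sub_H[OF NG] uv by blast
  note h = green_HD[OF H]
  have "L_le S (u \<star> s) (v \<star> s)" "L_le S (v \<star> s) (u \<star> s)"
    using H L_le_mult s h by (simp_all add: green_H_iff)
  then show J: "(u \<star> s, v \<star> s) \<in> green_J S" by (simp add: green_J_iff L_le_imp_J_le)
  obtain x y a b where *: "x \<in> N" "y \<in> N" "a \<in> carrier S" "b \<in> carrier S"
    "tgt S a = src S e" "src S b = src S e" "u = a \<star> x \<star> b" "v = a \<star> y \<star> b"
    using uv unfolding nu_iff[OF NG] by blast
  have xy: "x \<in> G" "y \<in> G" using * NG by auto
  have "tgt S b = src S s" using * s G_props[OF xy(1)] by (simp add: mult_simps)
  then have "b \<star> s \<in> carrier S" "src S (b \<star> s) = src S e" "u \<star> s = a \<star> x \<star> (b \<star> s)" "v \<star> s = a \<star> y \<star> (b \<star> s)"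
    using *(3-8) s(1) G_props[OF xy(1)] G_props[OF xy(2)] by (simp_all add: mult_simps)
  moreover assume "u \<star> s \<in> D"
  moreover from this have "v \<star> s \<in> D" using J J_class_eq[OF D_class] by blast
  ultimately show "(u \<star> s, v \<star> s) \<in> nu S D N"
    unfolding nu_iff[OF NG] using *(1-3,5) by blast
qed

lemma nu_mult_left:
  assumes NG: "N \<subseteq> G" and uv: "(u, v) \<in> nu S D N" and s: "s \<in> carrier S" "tgt S s = src S u"
  shows "(s \<star> u, s \<star> v) \<in> green_J S" and "s \<star> u \<in> D \<Longrightarrow> (s \<star> u, s \<star> v) \<in> nu S D N"
proof -
  have H: "(u, v) \<in> green_H S" using nu_sub_H[OF NG] uv by blast
  note h = green_HD[OF H]
  have "R_le S (s \<star> u) (s \<star> v)" "R_le S (s \<star> v) (s \<star> u)"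
    using H R_le_mult s h by (simp_all add: green_H_iff)
  then show J: "(s \<star> u, s \<star> v) \<in> green_J S" by (simp add: green_J_iff R_le_imp_J_le)
  obtain x y a b where *: "x \<in> N" "y \<in> N" "a \<in> carrier S" "b \<in> carrier S"
    "tgt S a = src S e" "src S b = src S e" "u = a \<star> x \<star> b" "v = a \<star> y \<star> b"
    using uv unfolding nu_iff[OF NG] by blast
  have xy: "x \<in> G" "y \<in> G" using * NG by auto
  have "tgt S s = src S a" using * s G_props[OF xy(1)] by (simp add: mult_simps)
  then have "s \<star> a \<in> carrier S" "tgt S (s \<star> a) = src S e" "s \<star> u = s \<star> a \<star> x \<star> b" "s \<star> v = s \<star> a \<star> y \<star> b"
    using *(3-8) s(1) G_props[OF xy(1)] G_props[OF xy(2)] by (simp_all add: mult_simps)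
  moreover assume "s \<star> u \<in> D"
  moreover from this have "s \<star> v \<in> D" using J J_class_eq[OF D_class] by blast
  ultimately show "(s \<star> u, s \<star> v) \<in> nu S D N"
    unfolding nu_iff[OF NG] using *(1,2,4,6) by blast
qed

end

section \<open>Chains of ideals\<close>

lemma is_ideal_restrict:
  "is_ideal S A \<Longrightarrow> A \<subseteq> B \<Longrightarrow> B \<subseteq> carrier S \<Longrightarrow> is_ideal (restrict_to S B) A"
  unfolding is_ideal_def by auto

locale ideal_chain =
  fixes U :: "('a, 'c) partial_semigroup" and \<xi> :: enat and D :: "nat \<Rightarrow> 'a set"
  assumes chain: "chain_of_ideals U \<xi> D"
begin

sublocale stable_partial_semigroup U
proof -
  interpret is_partial_semigroup U using chain by (simp add: chain_of_ideals_def)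
  show "stable_partial_semigroup U"
    using chain by unfold_locales (auto simp: chain_of_ideals_def)
qed

abbreviation I :: "enat \<Rightarrow> ('a, 'c) partial_semigroup" where
  "I s \<equiv> restrict_to U (ideal_up_to D s)"

lemma D_class: "enat q < \<xi> \<Longrightarrow> D q \<in> carrier U // green_J U"
  using chain by (auto simp: chain_of_ideals_def)

lemma D_nonempty: "enat q < \<xi> \<Longrightarrow> D q \<noteq> {}"
  using in_quotient_imp_non_empty[OF equiv_green_J] D_class by blast

lemma D_sub: "enat q < \<xi> \<Longrightarrow> D q \<subseteq> carrier U"
  using in_quotient_imp_subset[OF equiv_green_J] D_class by blast

lemma D_cover:
  assumes "x \<in> carrier U"
  obtains q where "enat q < \<xi>" "x \<in> D q"
proof -
  have "green_J U `` {x} \<in> D ` {q. enat q < \<xi>}"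
    using assms chain unfolding chain_of_ideals_def by (metis quotientI)
  moreover have "x \<in> green_J U `` {x}" using assms J_le_refl by (simp add: green_J_iff)
  ultimately show ?thesis using that by auto
qed

lemma D_less: "p < q \<Longrightarrow> enat q < \<xi> \<Longrightarrow> J_class_less U (D p) (D q)"
  using chain by (auto simp: chain_of_ideals_def)

lemma D_index_unique:
  assumes "enat p < \<xi>" "enat q < \<xi>" "x \<in> D p" "y \<in> D q" "(x, y) \<in> green_J U"
  shows "p = q"
proof (rule ccontr)
  have "D p = D q"
    using J_class_eq[OF D_class[OF assms(1)] assms(3)] J_class_eq[OF D_class[OF assms(2)] assms(4)] assms(5)
      equiv_green_J by (metis equiv_class_eq_iff Image_singleton)
  moreover assume "p \<noteq> q"
  ultimately show False
    using D_less[of p q] D_less[of q p] assms(1,2) by (auto simp: J_class_less_def neq_iff)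
qed

lemma D_disjoint: "\<lbrakk>enat p < \<xi>; enat q < \<xi>; x \<in> D p; x \<in> D q\<rbrakk> \<Longrightarrow> p = q"
  using D_index_unique[of p q x x] D_sub J_le_refl by (auto simp: green_J_iff)

text \<open>The chain only gives the direction from indices to the \<J>-order. Conversely, if
  \<open>q < p\<close>, the two elements would be \<J>-below each other, so their indices would
  agree.\<close>

lemma J_le_index:
  assumes "enat p < \<xi>" "enat q < \<xi>" "x \<in> D p" "y \<in> D q"
  shows "J_le U x y \<longleftrightarrow> p \<le> q"
proof -
  have less: "J_le U x y" if "p < q" "enat q < \<xi>" "x \<in> D p" "y \<in> D q" for p q x y
    using D_less[OF that(1,2)] that D_sub[OF that(2)]
    by (auto simp: J_class_less_def J_class_le_def two_sided_ideal_eq subset_iff)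
  show ?thesis
  proof
    assume J: "J_le U x y"
    show "p \<le> q"
    proof (rule ccontr)
      assume "\<not> p \<le> q"
      then have "J_le U y x" using less[of q p y x] assms by simp
      then have "p = q" using J D_index_unique[OF assms] by (simp add: green_J_iff)
      then show False using \<open>\<not> p \<le> q\<close> by simp
    qed
  next
    assume "p \<le> q"
    show "J_le U x y"
    proof (cases "p = q")
      case True
      then have "y \<in> {y. (x, y) \<in> green_J U}" using J_class_eq[OF D_class[OF assms(1)] assms(3)] assms(4) by simp
      then show ?thesis by (simp add: green_J_iff)
    next
      case False
      then show ?thesis using less[of p q x y] assms \<open>p \<le> q\<close> by simp
    qed
  qed
qed

text \<open>Treats \<open>r < \<xi>\<close> and \<open>r = \<xi> = \<infinity>\<close> alike: in
  both cases every finite index up to \<open>r\<close> names a class.\<close>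

definition level :: "enat \<Rightarrow> bool" where
  "level r \<longleftrightarrow> (\<forall>q. enat q \<le> r \<longrightarrow> enat q < \<xi>)"

lemma levelD: "level r \<Longrightarrow> enat q \<le> r \<Longrightarrow> enat q < \<xi>"
  by (simp add: level_def)

lemma level_le: "level r \<Longrightarrow> s \<le> r \<Longrightarrow> level s"
  unfolding level_def by (meson order_trans)

lemma ideal_up_to_D: "level r \<Longrightarrow> enat q < \<xi> \<Longrightarrow> x \<in> D q \<Longrightarrow> x \<in> ideal_up_to D r \<longleftrightarrow> enat q \<le> r"
  unfolding ideal_up_to_def using D_disjoint levelD by blast

lemma ideal_up_toE:
  assumes "level r" "x \<in> ideal_up_to D r"
  obtains q where "enat q \<le> r" "enat q < \<xi>" "x \<in> D q"
  using assms levelD unfolding ideal_up_to_def by blast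

lemma D_sub_ideal: "enat q \<le> r \<Longrightarrow> D q \<subseteq> ideal_up_to D r"
  unfolding ideal_up_to_def by blast

lemma ideal_mono: "s \<le> r \<Longrightarrow> ideal_up_to D s \<subseteq> ideal_up_to D r"
  unfolding ideal_up_to_def by (blast intro: order_trans)

lemma ideal_up_to_J_le:
  assumes "level r" "y \<in> ideal_up_to D r" "J_le U x y"
  shows "x \<in> ideal_up_to D r"
proof -
  obtain q where q: "enat q \<le> r" "enat q < \<xi>" "y \<in> D q" using ideal_up_toE assms by blast
  obtain p where p: "enat p < \<xi>" "x \<in> D p" using D_cover J_leD(1)[OF assms(3)] by blast
  have "p \<le> q" using J_le_index[OF p(1) q(2) p(2) q(3)] assms(3) by simp
  then have "enat p \<le> r" using q(1) by (meson enat_ord_simps(1) order_trans)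
  then show ?thesis using D_sub_ideal p by blast
qed

lemma ideal: "level r \<Longrightarrow> is_ideal U (ideal_up_to D r)"
proof -
  assume l: "level r"
  have z: "enat 0 \<le> r" by (simp flip: zero_enat_def)
  have sub: "ideal_up_to D r \<subseteq> carrier U"
    using ideal_up_toE[OF l] D_sub by blast
  moreover have "ideal_up_to D r \<noteq> {}" using D_sub_ideal[OF z] D_nonempty[OF levelD[OF l z]] by blast
  ultimately show ?thesis
    unfolding is_ideal_def using ideal_up_to_J_le[OF l] J_le_mult by blast
qed

text \<open>Identifies the complement of the top class, as it occurs in \<open>Sep_zeta\<close>,
  with the previous ideal of the chain.\<close>

lemma ideal_Suc:
  assumes "level (enat (Suc s))"
  shows "ideal_up_to D (enat (Suc s)) - D (Suc s) = ideal_up_to D (enat s)"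
proof -
  have "x \<in> D (Suc s) \<Longrightarrow> x \<notin> ideal_up_to D (enat s)" for x
    using ideal_up_to_D[OF level_le[OF assms], of "enat s" "Suc s" x] levelD[OF assms] by simp
  then show ?thesis
    unfolding ideal_up_to_def by (auto simp: le_Suc_eq)
qed

text \<open>\<open>max_J_class\<close> is a definite description, so uniqueness is needed besides
  maximality: two maximal classes lie below each other and therefore coincide.\<close>

lemma max_J_class_I:
  assumes l: "level (enat s)"
  shows "max_J_class (I (enat s)) = D s"
proof -
  let ?A = "ideal_up_to D (enat s)"
  have s: "enat s < \<xi>" using levelD[OF l] by simp
  interpret T: stable_partial_semigroup "I (enat s)" by (rule restrict_stable[OF ideal[OF l]])
  have cls: "D s \<in> ?A // green_J (I (enat s))"
    by (rule J_class_restrict[OF ideal[OF l] D_class[OF s]]) (simp add: D_sub_ideal)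
  have "is_max_J_class (I (enat s)) (D s)"
    unfolding is_max_J_class_def
  proof (intro conjI ballI)
    show "D s \<in> carrier (I (enat s)) // green_J (I (enat s))" using cls by simp
    fix J assume "J \<in> carrier (I (enat s)) // green_J (I (enat s))"
    then have J: "J \<subseteq> ?A" by (auto simp: quotient_def green_J_restrict[OF ideal[OF l]])
    show "J_class_le (I (enat s)) J (D s)"
      unfolding J_class_le_def
    proof (intro ballI)
      fix x y assume x: "x \<in> J" and y: "y \<in> D s"
      obtain p where p: "enat p \<le> enat s" "enat p < \<xi>" "x \<in> D p" using ideal_up_toE[OF l] x J by blast
      then have "J_le U x y" using J_le_index[OF p(2) s p(3) y] by simp
      then show "Inl x \<in> two_sided_ideal (I (enat s)) y"
        using x y J D_sub_ideal[of s "enat s"]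
        by (auto simp: T.two_sided_ideal_eq J_le_restrict[OF ideal[OF l]] subset_iff)
    qed
  qed
  moreover have "J = J'" if "is_max_J_class (I (enat s)) J" "is_max_J_class (I (enat s)) J'" for J J'
  proof -
    have c: "J \<in> ?A // green_J (I (enat s))" "J' \<in> ?A // green_J (I (enat s))"
      "J_class_le (I (enat s)) J J'" "J_class_le (I (enat s)) J' J"
      using that by (auto simp: is_max_J_class_def)
    obtain x y where xy: "x \<in> J" "y \<in> J'"
      using in_quotient_imp_non_empty[OF T.equiv_green_J] c by fastforce
    have in_A: "x \<in> ?A" "y \<in> ?A"
      using in_quotient_imp_subset[OF T.equiv_green_J] c xy by fastforce+
    have "Inl x \<in> two_sided_ideal (I (enat s)) y" "Inl y \<in> two_sided_ideal (I (enat s)) x"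
      using c(3,4) xy unfolding J_class_le_def by blast+
    then have "(x, y) \<in> green_J (I (enat s))"
      using in_A by (auto simp: T.green_J_iff T.two_sided_ideal_eq)
    then show ?thesis
      using quotient_eq_iff[OF T.equiv_green_J, of J J' x y] c xy by simp
  qed
  ultimately show ?thesis unfolding max_J_class_def by (intro the_equality) blast+
qed

end

section \<open>Congruences inside \<H> and NZ-tuples\<close>

locale chain_level = ideal_chain +
  fixes G :: "nat \<Rightarrow> 'a set" and r :: enat
  assumes G_class: "enat q < \<xi> \<Longrightarrow> group_H_class U (G q) \<and> G q \<subseteq> D q"
    and level_r: "level r"
begin

abbreviation T where "T \<equiv> I r"

lemma ideal_r: "is_ideal U (ideal_up_to D r)"
  using level_r by (rule ideal)

sublocale T: stable_partial_semigroup T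
  by (rule restrict_stable[OF ideal_r])

lemma green_H_T: "green_H T = green_H U \<inter> ideal_up_to D r \<times> ideal_up_to D r"
  by (rule green_H_restrict[OF ideal_r])

lemma class_at:
  assumes q: "enat q \<le> r"
  shows "group_class_in_J_class T (D q) (G q)"
proof
  have l: "enat q < \<xi>" using levelD[OF level_r q] .
  have sub: "D q \<subseteq> ideal_up_to D r" using D_sub_ideal[OF q] .
  show "D q \<in> carrier T // green_J T"
    using J_class_restrict[OF ideal_r D_class[OF l] sub] by simp
  have "group_H_class U (G q)" "G q \<subseteq> ideal_up_to D r" using G_class[OF l] sub by auto
  then show "group_H_class T (G q)"
    using H_class_restrict[OF ideal_r, of "G q"] by (auto simp: group_H_class_def)
  show "G q \<subseteq> D q" using G_class[OF l] by simp
qed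

lemma H_same_index: "(x, y) \<in> green_H T \<Longrightarrow> enat q \<le> r \<Longrightarrow> x \<in> D q \<Longrightarrow> y \<in> D q"
  using group_class_in_J_class.D_H_closed[OF class_at] by blast

lemma D_disjoint_r: "\<lbrakk>enat p \<le> r; enat q \<le> r; x \<in> D p; x \<in> D q\<rbrakk> \<Longrightarrow> p = q"
  using D_disjoint levelD[OF level_r] by blast

text \<open>For \<theta> inside \<H> this is the entry of its NZ-tuple at \<open>q\<close> (see
  \<open>NZ_of_eq\<close>). It is defined for every relation because in (ii) it also extracts the
  subgroup \<open>N\<close> from congruences that are not inside \<H>.\<close>

definition kernel_group :: "'a rel \<Rightarrow> nat \<Rightarrow> 'a set" where
  "kernel_group \<tau> q = {g \<in> G q. (\<one>\<^bsub>H_group T (G q)\<^esub>, g) \<in> \<tau>}"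

lemma kernel_group_normal: "\<tau> \<in> Cong T \<Longrightarrow> enat q \<le> r \<Longrightarrow> kernel_group \<tau> q \<lhd> H_group U (G q)"
  unfolding kernel_group_def using group_class_in_J_class.cong_normal[OF class_at] by simp

lemma cong_on_D:
  assumes "\<tau> \<in> Cong T" "enat q \<le> r" "\<tau> \<inter> D q \<times> D q \<subseteq> green_H T"
  shows "\<tau> \<inter> D q \<times> D q = nu T (D q) (kernel_group \<tau> q)"
  unfolding kernel_group_def using group_class_in_J_class.cong_class_eq_nu[OF class_at] assms by blast

lemma nu_D: "(u, v) \<in> nu S (D q) N \<Longrightarrow> u \<in> D q \<and> v \<in> D q"
  by (simp add: nu_def)

lemma Theta_iff:
  assumes "u \<in> D q" "enat q \<le> r"
  shows "(u, v) \<in> Theta T r D N \<longleftrightarrow> (u, v) \<in> nu T (D q) (N q)"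
  using assms D_disjoint_r unfolding Theta_def by (blast dest: nu_D)

lemma ThetaE:
  assumes "(u, v) \<in> Theta T r D N"
  obtains q where "enat q \<le> r" "u \<in> D q" "v \<in> D q" "(u, v) \<in> nu T (D q) (N q)"
  using assms nu_D unfolding Theta_def by blast

text \<open>\<H>-related elements share an index, so the blocks on the classes \<open>D q\<close>
  exhaust \<theta>. The \<open>down\<close> condition holds because \<theta> contains
  \<open>nu\<close> of its kernel group at \<open>q\<close>, hence also the congruence generated by
  it.\<close>

lemma Cong_H_eq_Theta:
  assumes \<theta>: "\<theta> \<in> Cong_H T"
  shows "\<theta> = Theta T r D (restrict (kernel_group \<theta>) {q. enat q \<le> r})"
    and "NZ_tuple T r D G (restrict (kernel_group \<theta>) {q. enat q \<le> r})"
proof -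
  have C: "\<theta> \<in> Cong T" "\<theta> \<subseteq> green_H T" using \<theta> by (auto simp: Cong_H_def)
  have nu: "\<theta> \<inter> D q \<times> D q = nu T (D q) (kernel_group \<theta> q)" if "enat q \<le> r" for q
    using cong_on_D[OF C(1) that] C(2) by blast
  have "(u, v) \<in> \<theta> \<longleftrightarrow> (u, v) \<in> Theta T r D (restrict (kernel_group \<theta>) {q. enat q \<le> r})" for u v
  proof
    assume uv: "(u, v) \<in> \<theta>"
    then have "u \<in> ideal_up_to D r" using congD(1)[OF C(1)] by simp
    then obtain q where q: "enat q \<le> r" "u \<in> D q" using ideal_up_toE[OF level_r] by blast
    then have "v \<in> D q" using H_same_index C(2) uv by blast
    then show "(u, v) \<in> Theta T r D (restrict (kernel_group \<theta>) {q. enat q \<le> r})"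
      using Theta_iff[OF q(2,1)] nu[OF q(1)] uv q by auto
  next
    assume "(u, v) \<in> Theta T r D (restrict (kernel_group \<theta>) {q. enat q \<le> r})"
    then show "(u, v) \<in> \<theta>" using nu by (elim ThetaE) auto
  qed
  then show "\<theta> = Theta T r D (restrict (kernel_group \<theta>) {q. enat q \<le> r})" by auto
  have "down T (D q) (G p) (kernel_group \<theta> q) \<subseteq> kernel_group \<theta> p" if "enat q \<le> r" for p q
    using cong_gen_subset[OF C(1), of "nu T (D q) (kernel_group \<theta> q)"] nu[OF that]
    unfolding down_def kernel_group_def by blast
  moreover have "enat p \<le> r" if "p \<le> q" "enat q \<le> r" for p q
    using that by (meson enat_ord_simps(1) order_trans)
  ultimately show "NZ_tuple T r D G (restrict (kernel_group \<theta>) {q. enat q \<le> r})"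
    using kernel_group_normal[OF C(1)] T.zeta_upper[OF \<theta>]
    unfolding NZ_tuple_def Z_group_def by (auto simp: kernel_group_def)
qed

text \<open>At the identity of \<open>G q\<close> the relation \<open>Theta\<close> is just its
  block at \<open>q\<close>, from which \<open>nu_e_iff\<close> recovers \<open>N q\<close>. The
  definite description in \<open>NZ_of\<close> therefore has at most one candidate.\<close>

lemma NZ_tuple_eq_kernel_group:
  assumes N: "NZ_tuple T r D G N"
  shows "N = restrict (kernel_group (Theta T r D N)) {q. enat q \<le> r}"
proof (rule extensionalityI[of _ "{q. enat q \<le> r}"])
  show "N \<in> extensional {q. enat q \<le> r}" using N by (simp add: NZ_tuple_def)
  fix q assume "q \<in> {q. enat q \<le> r}"
  then have q: "enat q \<le> r" by simp
  interpret q: group_class_in_J_class T "D q" "G q" by (rule class_at[OF q])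
  have Nq: "N q \<lhd> H_group T (G q)" using N q by (simp add: NZ_tuple_def)
  then have "N q \<subseteq> G q" using subgroup.subset[OF normal_imp_subgroup] by fastforce
  then have "N q = kernel_group (Theta T r D N) q"
    using q.nu_e_iff[OF Nq] q.e_in q.G_sub_D Theta_iff[OF _ q, of q.e _ N]
    unfolding kernel_group_def by auto
  then show "N q = restrict (kernel_group (Theta T r D N)) {q. enat q \<le> r} q" using q by simp
qed auto

lemma NZ_of_eq:
  assumes \<theta>: "\<theta> \<in> Cong_H T"
  shows "NZ_of T r D G \<theta> = restrict (kernel_group \<theta>) {q. enat q \<le> r}"
  unfolding NZ_of_def
  by (rule the_equality) (use Cong_H_eq_Theta[OF \<theta>] NZ_tuple_eq_kernel_group in auto)

lemma Theta_Cong_H: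
  assumes N: "NZ_tuple T r D G N"
  shows "Theta T r D N \<in> Cong_H T"
proof -
  have Nq: "N q \<lhd> H_group T (G q)" "N q \<subseteq> G q" "N q \<subseteq> Z_group T (G q)" if "enat q \<le> r" for q
    using N that by (auto simp: NZ_tuple_def Z_group_def)
  have zC: "zeta T \<in> Cong T" "zeta T \<subseteq> green_H T" using T.zeta_Cong_H by (auto simp: Cong_H_def)
  \<comment> \<open>Left and right multiples are treated together: \<open>(w, z)\<close> is a pair
    lying in every congruence that contains \<open>(u, v)\<close>. Since \<open>N q\<close> lies in
    \<open>Z_group\<close>, the pair \<open>(u, v)\<close> is in \<zeta>, so \<open>(w, z)\<close>
    is an \<H>-pair; its coordinate in \<open>G p\<close> lies in the \<open>down\<close> group and
    hence in \<open>N p\<close>.\<close>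
  have mult: "w \<in> carrier T \<Longrightarrow> (w, z) \<in> Theta T r D N"
    if q: "enat q \<le> r" and uv: "(u, v) \<in> nu T (D q) (N q)"
      and gen: "\<And>\<tau>. \<tau> \<in> Cong T \<Longrightarrow> (u, v) \<in> \<tau> \<Longrightarrow> (w, z) \<in> \<tau>"
      and J: "J_le U w u" for q u v w z
  proof -
    assume w: "w \<in> carrier T"
    interpret q: group_class_in_J_class T "D q" "G q" by (rule class_at[OF q])
    obtain p where p: "enat p \<le> r" "w \<in> D p" using w ideal_up_toE[OF level_r] by auto
    interpret p: group_class_in_J_class T "D p" "G p" by (rule class_at[OF p(1)])
    have u: "u \<in> D q" using uv nu_D by blast
    have pq: "p \<le> q" using J_le_index[OF _ _ p(2) u] levelD[OF level_r] p(1) q J by blast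
    have "nu T (D q) (N q) \<subseteq> zeta T"
    proof -
      have "N q \<subseteq> kernel_group (zeta T) q" using Nq[OF q] by (auto simp: Z_group_def kernel_group_def)
      then have "nu T (D q) (N q) \<subseteq> nu T (D q) (kernel_group (zeta T) q)" unfolding nu_def by blast
      also have "\<dots> \<subseteq> zeta T" using cong_on_D[OF zC(1) q] zC(2) by blast
      finally show ?thesis .
    qed
    then have H: "(w, z) \<in> green_H T" using gen[OF zC(1)] uv zC(2) by blast
    obtain c s c' s' where co: "p.green_coords w c s c' s'" using p.green_coords_exist[OF p(2)] .
    have "(p.e, c \<star>\<^bsub>T\<^esub> z \<star>\<^bsub>T\<^esub> s) \<in> cong_gen T (nu T (D q) (N q))"
      using p.cong_coords[OF _ gen co] uv by (intro cong_genI) blast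
    then have "c \<star>\<^bsub>T\<^esub> z \<star>\<^bsub>T\<^esub> s \<in> down T (D q) (G p) (N q)"
      using p.green_coordsD(15)[OF co H] by (simp add: down_def)
    then have "c \<star>\<^bsub>T\<^esub> z \<star>\<^bsub>T\<^esub> s \<in> N p" using N[unfolded NZ_tuple_def] pq q by blast
    then show "(w, z) \<in> Theta T r D N"
      using p.nu_coords_iff[OF Nq(1)[OF p(1)] p(2) co] H Theta_iff[OF p(2,1)] by blast
  qed
  have sub: "Theta T r D N \<subseteq> green_H T"
    using group_class_in_J_class.nu_sub_H[OF class_at Nq(2)] unfolding Theta_def by blast
  have carr: "x \<in> carrier U" if "x \<in> ideal_up_to D r" for x
    using that ideal_r by (auto simp: is_ideal_def)
  have "Theta T r D N \<in> Cong T"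
  proof (rule CongI)
    fix x y assume xy: "(x, y) \<in> Theta T r D N"
    then obtain q where q: "enat q \<le> r" "x \<in> D q" "y \<in> D q" "(x, y) \<in> nu T (D q) (N q)" by (rule ThetaE)
    note H = T.green_HD[OF subsetD[OF sub xy]]
    show "x \<in> carrier T \<and> parallel T x y \<and> (y, x) \<in> Theta T r D N"
      using H group_class_in_J_class.nu_sym[OF class_at Nq(2) q(4)] q Theta_iff[OF q(3,1)]
      by (simp add: parallel_def)
    fix s assume s: "s \<in> carrier T"
    { assume t: "tgt T x = src T s"
      show "(x \<star>\<^bsub>T\<^esub> s, y \<star>\<^bsub>T\<^esub> s) \<in> Theta T r D N"
        using mult[OF q(1,4) cong_mult_right[OF _ _ s t]] J_le_mult(1)[of x s] T.mult_closed[OF H(1) s t]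
          H s t carr by simp }
    { assume t: "tgt T s = src T x"
      show "(s \<star>\<^bsub>T\<^esub> x, s \<star>\<^bsub>T\<^esub> y) \<in> Theta T r D N"
        using mult[OF q(1,4) cong_mult_left[OF _ _ s t]] J_le_mult(2)[of x s] T.mult_closed[OF s H(1) t]
          H s t carr by simp }
  next
    fix x assume "x \<in> carrier T"
    then obtain q where q: "enat q \<le> r" "x \<in> D q" using ideal_up_toE[OF level_r] by auto
    then show "(x, x) \<in> Theta T r D N"
      using group_class_in_J_class.nu_refl[OF class_at Nq(1)] Theta_iff by blast
  next
    fix x y z assume xy: "(x, y) \<in> Theta T r D N" and yz: "(y, z) \<in> Theta T r D N"
    obtain q where q: "enat q \<le> r" "x \<in> D q" "y \<in> D q" "(x, y) \<in> nu T (D q) (N q)"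
      using xy by (rule ThetaE)
    then show "(x, z) \<in> Theta T r D N"
      using group_class_in_J_class.nu_trans[OF class_at Nq(1) q(4)] yz Theta_iff by blast
  qed
  then show ?thesis using sub by (simp add: Cong_H_def)
qed

lemma Cong_H_eq: "Cong_H T = {Theta T r D N | N. NZ_tuple T r D G N}"
  using Theta_Cong_H Cong_H_eq_Theta by blast

text \<open>The ideal \<open>?A\<close>, the class \<open>D (Suc q)\<close> and the remainder are
  unions of classes of the relation. It is universal on the first, equal to \<open>nu\<close> of
  \<open>N\<close> on the second, where the bound on the kernel group absorbs \<theta>, and equal to
  \<theta> on the third. A multiple of a \<open>nu\<close>-pair either stays in
  \<open>D (Suc q)\<close> or drops into \<open>?A\<close> with both members.\<close>

lemma rees_cong_nu_union_Cong:
  assumes q: "enat q < r" and N: "N \<lhd> H_group U (G (Suc q))" and \<theta>: "\<theta> \<in> Cong_H T"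
    and sub: "kernel_group \<theta> (Suc q) \<subseteq> N"
  shows "rees_cong_nu T (carrier (I (enat q))) (D (Suc q)) N \<union> \<theta> \<in> Cong T" (is "?\<rho> \<in> _")
proof -
  let ?A = "ideal_up_to D (enat q)" and ?B = "ideal_up_to D (enat (Suc q))" and ?\<nu> = "nu T (D (Suc q)) N"
  have C: "\<theta> \<in> Cong T" "\<theta> \<subseteq> green_H T" using \<theta> by (auto simp: Cong_H_def)
  have q1: "enat (Suc q) \<le> r" using q by (simp add: Suc_ile_eq)
  have lA: "level (enat q)" and lB: "level (enat (Suc q))"
    using level_le[OF level_r] q q1 by simp_all
  interpret g: group_class_in_J_class T "D (Suc q)" "G (Suc q)" by (rule class_at[OF q1])
  have N': "N \<lhd> H_group T (G (Suc q))" using N by simp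
  have NG: "N \<subseteq> G (Suc q)" using subgroup.subset[OF normal_imp_subgroup[OF N']] by simp
  have AT: "?A \<subseteq> carrier T" using ideal_mono[of "enat q" r] q by simp
  have iA: "is_ideal T ?A"
    using is_ideal_restrict[OF ideal[OF lA] ideal_mono[of "enat q" r]] q ideal_r by (simp add: is_ideal_def)
  have split: "x \<in> ?A \<Longrightarrow> x \<notin> D (Suc q)" for x using ideal_Suc[OF lB] by blast
  have \<rho>: "(x, y) \<in> ?\<rho> \<longleftrightarrow> x \<in> ?A \<and> y \<in> ?A \<and> parallel T x y \<or> (x, y) \<in> ?\<nu> \<or> (x, y) \<in> \<theta>" for x y
    using cong_refl[OF C(1)] by (auto simp: rees_cong_nu_def rees_cong_def nabla_def parallel_def)
  have JA: "x \<in> ?A \<longleftrightarrow> y \<in> ?A" if "(x, y) \<in> green_J T" for x y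
  proof -
    have "(x, y) \<in> green_J U" using that by (auto simp: green_J_restrict[OF ideal_r])
    then show ?thesis using ideal_up_to_J_le[OF lA] by (auto simp: green_J_iff)
  qed
  have JB: "x \<in> ?B \<Longrightarrow> J_le U y x \<Longrightarrow> y \<in> ?A \<or> y \<in> D (Suc q)" for x y
    using ideal_up_to_J_le[OF lB] ideal_Suc[OF lB] by blast
  have \<theta>A: "x \<in> ?A \<longleftrightarrow> y \<in> ?A" if "(x, y) \<in> \<theta>" for x y
    using that C(2) T.green_H_imp_J JA by blast
  have \<theta>D: "(x, y) \<in> ?\<nu>" if "(x, y) \<in> \<theta>" "x \<in> D (Suc q)" for x y
  proof -
    have "y \<in> D (Suc q)" using H_same_index[OF _ q1 that(2)] C(2) that(1) by blast
    moreover have "\<theta> \<inter> D (Suc q) \<times> D (Suc q) \<subseteq> green_H T" using C(2) by blast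
    ultimately have "(x, y) \<in> nu T (D (Suc q)) (kernel_group \<theta> (Suc q))"
      using cong_on_D[OF C(1) q1] that by blast
    then show ?thesis using sub unfolding nu_def by blast
  qed
  have region_A: "y \<in> ?A \<and> parallel T x y" if "(x, y) \<in> ?\<rho>" "x \<in> ?A" for x y
    using that split[OF that(2)] \<theta>A[of x y] congD(3,4)[OF C(1), of x y] nu_D[of x y]
    unfolding \<rho> parallel_def by blast
  have region_D: "(x, y) \<in> ?\<nu>" if "(x, y) \<in> ?\<rho>" "x \<in> D (Suc q)" for x y
    using that split \<theta>D unfolding \<rho> by blast
  have region_top: "(x, y) \<in> \<theta>" if "(x, y) \<in> ?\<rho>" "x \<notin> ?A" "x \<notin> D (Suc q)" for x y
    using that nu_D unfolding \<rho> by blast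
  have \<nu>T: "x \<in> carrier T \<and> parallel T x y" if "(x, y) \<in> ?\<nu>" for x y
    using T.green_HD[OF subsetD[OF g.nu_sub_H[OF NG] that]] by (simp add: parallel_def)
  have carr: "x \<in> carrier T \<and> parallel T x y \<and> (y, x) \<in> ?\<rho>" if xy: "(x, y) \<in> ?\<rho>" for x y
    using xy AT \<nu>T[of x y] g.nu_sym[OF NG, of x y] congD[OF C(1), of x y]
    unfolding \<rho> parallel_def by auto
  have TU: "carrier T \<subseteq> carrier U" using ideal_r by (simp add: is_ideal_def)
  have DB: "D (Suc q) \<subseteq> ?B" by (simp add: D_sub_ideal)
  show ?thesis
  proof (rule CongI)
    fix x y assume xy: "(x, y) \<in> ?\<rho>"
    show "x \<in> carrier T \<and> parallel T x y \<and> (y, x) \<in> ?\<rho>" using carr[OF xy] .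
    have x: "x \<in> carrier T" "y \<in> carrier T" and p: "parallel T x y"
      using carr[OF xy] carr[of y x] by auto
    fix s assume s: "s \<in> carrier T"
    { assume t: "tgt T x = src T s"
      have t': "tgt T y = src T s" using p t by (simp add: parallel_def)
      have par: "parallel T (x \<star>\<^bsub>T\<^esub> s) (y \<star>\<^bsub>T\<^esub> s)"
        using T.src_mult[OF x(1) s t] T.src_mult[OF x(2) s t'] T.tgt_mult[OF x(1) s t] T.tgt_mult[OF x(2) s t'] p
        by (simp add: parallel_def)
      consider "x \<in> ?A" "y \<in> ?A" | "(x, y) \<in> ?\<nu>" | "(x, y) \<in> \<theta>" using xy \<rho> by blast
      then show "(x \<star>\<^bsub>T\<^esub> s, y \<star>\<^bsub>T\<^esub> s) \<in> ?\<rho>"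
      proof cases
        case 1
        then have "x \<star>\<^bsub>T\<^esub> s \<in> ?A" "y \<star>\<^bsub>T\<^esub> s \<in> ?A" using iA s t t' unfolding is_ideal_def by blast+
        then show ?thesis using par \<rho> by blast
      next
        case 2
        have "J_le U (x \<star>\<^bsub>T\<^esub> s) x" using J_le_mult(1)[of x s] x s t TU by auto
        then have "x \<star>\<^bsub>T\<^esub> s \<in> ?A \<or> x \<star>\<^bsub>T\<^esub> s \<in> D (Suc q)" using JB nu_D[OF 2] DB by blast
        then show ?thesis
          using g.nu_mult_right[OF NG 2 s t] JA par \<rho> by blast
      next
        case 3
        then show ?thesis using cong_mult_right[OF C(1) 3 s t] \<rho> by blast
      qed }
    { assume t: "tgt T s = src T x"
      have t': "tgt T s = src T y" using p t by (simp add: parallel_def)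
      have par: "parallel T (s \<star>\<^bsub>T\<^esub> x) (s \<star>\<^bsub>T\<^esub> y)"
        using T.src_mult[OF s x(1) t] T.src_mult[OF s x(2) t'] T.tgt_mult[OF s x(1) t] T.tgt_mult[OF s x(2) t'] p
        by (simp add: parallel_def)
      consider "x \<in> ?A" "y \<in> ?A" | "(x, y) \<in> ?\<nu>" | "(x, y) \<in> \<theta>" using xy \<rho> by blast
      then show "(s \<star>\<^bsub>T\<^esub> x, s \<star>\<^bsub>T\<^esub> y) \<in> ?\<rho>"
      proof cases
        case 1
        then have "s \<star>\<^bsub>T\<^esub> x \<in> ?A" "s \<star>\<^bsub>T\<^esub> y \<in> ?A" using iA s t t' unfolding is_ideal_def by blast+
        then show ?thesis using par \<rho> by blast
      next
        case 2
        have "J_le U (s \<star>\<^bsub>T\<^esub> x) x" using J_le_mult(2)[of x s] x s t TU by auto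
        then have "s \<star>\<^bsub>T\<^esub> x \<in> ?A \<or> s \<star>\<^bsub>T\<^esub> x \<in> D (Suc q)" using JB nu_D[OF 2] DB by blast
        then show ?thesis
          using g.nu_mult_left[OF NG 2 s t] JA par \<rho> by blast
      next
        case 3
        then show ?thesis using cong_mult_left[OF C(1) 3 s t] \<rho> by blast
      qed }
  next
    fix x assume "x \<in> carrier T"
    then show "(x, x) \<in> ?\<rho>" using cong_refl[OF C(1)] by blast
  next
    fix x y z assume xy: "(x, y) \<in> ?\<rho>" and yz: "(y, z) \<in> ?\<rho>"
    consider "x \<in> ?A" | "x \<in> D (Suc q)" | "x \<notin> ?A" "x \<notin> D (Suc q)" by blast
    then show "(x, z) \<in> ?\<rho>"
    proof cases
      case 1
      then have "y \<in> ?A" "parallel T x y" using region_A[OF xy] by auto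
      moreover from this have "z \<in> ?A" "parallel T y z" using region_A[OF yz] by auto
      ultimately show ?thesis using 1 \<rho> by (auto simp: parallel_def)
    next
      case 2
      then have xy': "(x, y) \<in> ?\<nu>" using region_D[OF xy] by blast
      then have "(y, z) \<in> ?\<nu>" using region_D[OF yz] nu_D by blast
      then show ?thesis using g.nu_trans[OF N' xy'] \<rho> by blast
    next
      case 3
      then have xy': "(x, y) \<in> \<theta>" using region_top[OF xy] by blast
      have "y \<notin> ?A" using \<theta>A[OF xy'] 3 by blast
      moreover have "y \<notin> D (Suc q)"
        using H_same_index[OF _ q1, of y x] congD(5)[OF C(1) xy'] C(2) 3 by blast
      ultimately have "(y, z) \<in> \<theta>" using region_top[OF yz] by blast
      then show ?thesis using cong_trans[OF C(1) xy'] \<rho> by blast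
    qed
  qed
qed

end

section \<open>Congruences under the separation properties\<close>

locale separated_chain = chain_level +
  fixes k :: nat
  assumes k_le: "enat k \<le> r"
    and lift: "\<sigma> \<in> Cong (I (enat k)) \<Longrightarrow> liftable U \<sigma>"
    and gen: "nabla_gen (I (enat k))"
    and sep: "k < s \<Longrightarrow> enat s < \<xi> \<Longrightarrow> Sep_zeta (I (enat s))"
begin

lemma level_s: "enat s \<le> r \<Longrightarrow> level (enat s)"
  using level_le[OF level_r] .

lemma ideal_in_T: "enat s \<le> r \<Longrightarrow> is_ideal T (ideal_up_to D (enat s))"
  using is_ideal_restrict[OF ideal[OF level_s] ideal_mono] ideal_r by (simp add: is_ideal_def)

text \<open>The conditions of \<open>Sep_zeta\<close> for \<open>I (s + 1)\<close>, with \<H> and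
  \<zeta> read in \<open>U\<close>, so that the pair found at one level can be used at the next. The
  pairs from (S1) and (S3) have the shape required by \<open>nabla_of_non_H_pair\<close> at
  \<open>s\<close>.\<close>

lemma separation:
  assumes s: "k \<le> s" "enat (Suc s) \<le> r"
  shows S1: "\<lbrakk>x \<in> D (Suc s); y \<in> ideal_up_to D (enat s); parallel U x y\<rbrakk> \<Longrightarrow>
      \<exists>x' y'. (x', y') \<in> cong_gen (I (enat (Suc s))) {(x, y)} \<and> x' \<in> D s \<and>
        y' \<in> ideal_up_to D (enat s) \<and> (x', y') \<notin> green_H U"
    and S2: "\<lbrakk>x \<in> D (Suc s); y \<in> D (Suc s); (x, y) \<notin> green_H U; parallel U x y\<rbrakk> \<Longrightarrow>
      \<exists>x' y'. (x', y') \<in> cong_gen (I (enat (Suc s))) {(x, y)} \<and> x' \<in> D (Suc s) \<and> y' \<in> ideal_up_to D (enat s)"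
    and S3: "\<lbrakk>x \<in> D (Suc s); y \<in> D (Suc s); (x, y) \<in> green_H U; (x, y) \<notin> zeta U\<rbrakk> \<Longrightarrow>
      \<exists>x' y'. (x', y') \<in> cong_gen (I (enat (Suc s))) {(x, y)} \<and> x' \<in> D s \<and>
        y' \<in> ideal_up_to D (enat s) \<and> (x', y') \<notin> green_H U"
proof -
  let ?A = "ideal_up_to D (enat s)" and ?B = "ideal_up_to D (enat (Suc s))"
  have l: "level (enat (Suc s))" using level_s[OF s(2)] .
  have l': "level (enat s)" using level_le[OF l] by simp
  have Sep: "Sep_zeta (I (enat (Suc s)))" using sep[of "Suc s"] s levelD[OF l] by simp
  have DB: "D (Suc s) \<subseteq> ?B" and DA: "D s \<subseteq> ?A" using D_sub_ideal by simp_all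
  note HB = green_H_restrict[OF ideal[OF l]] and HA = green_H_restrict[OF ideal[OF l']]
    and zB = zeta_restrict[OF ideal[OF l]]
  have 1: "\<forall>x \<in> D (Suc s). \<forall>y \<in> ?A. parallel U x y \<longrightarrow>
         (\<exists>(x', y') \<in> cong_gen (I (enat (Suc s))) {(x, y)}. x' \<in> D s \<and> y' \<in> ?A - green_H (I (enat s)) `` {x'})"
    and 2: "\<forall>x \<in> D (Suc s). \<forall>y \<in> D (Suc s) - green_H (I (enat (Suc s))) `` {x}. parallel U x y \<longrightarrow>
         (\<exists>(x', y') \<in> cong_gen (I (enat (Suc s))) {(x, y)}. x' \<in> D (Suc s) \<and> y' \<in> ?A)"
    and 3: "\<forall>x \<in> D (Suc s). \<forall>y \<in> D (Suc s). (x, y) \<in> green_H (I (enat (Suc s))) - zeta (I (enat (Suc s))) \<longrightarrow>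
         (\<exists>(x', y') \<in> cong_gen (I (enat (Suc s))) {(x, y)}. x' \<in> D s \<and> y' \<in> ?A - green_H (I (enat s)) `` {x'})"
    using Sep unfolding Sep_zeta_def Let_def
    by (simp_all add: max_J_class_I[OF l] max_J_class_I[OF l'] ideal_Suc[OF l] parallel_def)
  show "\<exists>x' y'. (x', y') \<in> cong_gen (I (enat (Suc s))) {(x, y)} \<and> x' \<in> D s \<and>
        y' \<in> ?A \<and> (x', y') \<notin> green_H U"
    if xy: "x \<in> D (Suc s)" "y \<in> ?A" "parallel U x y"
  proof -
    obtain x' y' where *: "(x', y') \<in> cong_gen (I (enat (Suc s))) {(x, y)}" "x' \<in> D s"
      "y' \<in> ?A - green_H (I (enat s)) `` {x'}" using 1 xy by blast
    then have "(x', y') \<notin> green_H U" using DA by (auto simp: HA)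
    then show ?thesis using * by blast
  qed
  show "\<exists>x' y'. (x', y') \<in> cong_gen (I (enat (Suc s))) {(x, y)} \<and> x' \<in> D (Suc s) \<and> y' \<in> ?A"
    if xy: "x \<in> D (Suc s)" "y \<in> D (Suc s)" "(x, y) \<notin> green_H U" "parallel U x y"
  proof -
    have "y \<in> D (Suc s) - green_H (I (enat (Suc s))) `` {x}" using xy by (auto simp: HB)
    then show ?thesis using 2 xy by blast
  qed
  show "\<exists>x' y'. (x', y') \<in> cong_gen (I (enat (Suc s))) {(x, y)} \<and> x' \<in> D s \<and>
        y' \<in> ?A \<and> (x', y') \<notin> green_H U"
    if xy: "x \<in> D (Suc s)" "y \<in> D (Suc s)" "(x, y) \<in> green_H U" "(x, y) \<notin> zeta U"
  proof -
    have "(x, y) \<in> green_H (I (enat (Suc s))) - zeta (I (enat (Suc s)))"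
      using xy DB by (auto simp: HB zB)
    then obtain x' y' where *: "(x', y') \<in> cong_gen (I (enat (Suc s))) {(x, y)}" "x' \<in> D s"
      "y' \<in> ?A - green_H (I (enat s)) `` {x'}" using 3 xy by blast
    then have "(x', y') \<notin> green_H U" using DA by (auto simp: HA)
    then show ?thesis using * by blast
  qed
qed

lemma cong_gen_sub:
  assumes "\<tau> \<in> Cong T" "enat s \<le> r" "(x, y) \<in> \<tau>" "x \<in> ideal_up_to D (enat s)" "y \<in> ideal_up_to D (enat s)"
  shows "cong_gen (I (enat s)) {(x, y)} \<subseteq> \<tau>"
  using cong_gen_in_ideal[OF assms(1) ideal_in_T[OF assms(2)] assms(3-5)] by simp

lemma cong_parallel: "\<tau> \<in> Cong T \<Longrightarrow> (x, y) \<in> \<tau> \<Longrightarrow> parallel U x y"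
  using congD(3,4)[of \<tau> T x y] by (simp add: parallel_def)

lemma nabla_I: "nabla (I s) = {(x, y). x \<in> ideal_up_to D s \<and> y \<in> ideal_up_to D s \<and> parallel U x y}"
  by (simp add: nabla_def parallel_def)

lemma nabla_mono: "s \<le> s' \<Longrightarrow> nabla (I s) \<subseteq> nabla (I s')"
  using ideal_mono by (auto simp: nabla_I)

text \<open>One \<open>\<tau>\<close>-pair joining \<open>D (s + 1)\<close> to the ideal below it pushes every element of \<open>D (s + 1)\<close> into that ideal.\<close>

lemma nabla_step:
  assumes \<tau>: "\<tau> \<in> Cong T" and s: "enat (Suc s) \<le> r" and nab: "nabla (I (enat s)) \<subseteq> \<tau>"
    and xy: "(x, y) \<in> \<tau>" "x \<in> D (Suc s)" "y \<in> ideal_up_to D (enat s)"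
  shows "nabla (I (enat (Suc s))) \<subseteq> \<tau>"
proof -
  let ?A = "ideal_up_to D (enat s)" and ?B = "ideal_up_to D (enat (Suc s))"
  have s': "enat s \<le> r" using s by (meson enat_ord_simps(1) le_SucI order_refl order_trans)
  have l: "level (enat (Suc s))" using level_s s by blast
  have ex: "\<exists>u' \<in> ?A. (u, u') \<in> \<tau>" if u: "u \<in> ?B" for u
  proof (cases "u \<in> ?A")
    case True
    then have "u \<in> carrier T" using ideal_mono[OF s'] by auto
    then show ?thesis using True cong_refl[OF \<tau>] by blast
  next
    case False
    then have "u \<in> D (Suc s)" using u ideal_Suc[OF l] by blast
    then have "J_le U u x" using J_le_index[OF _ _ _ xy(2), of "Suc s" u] levelD[OF l] by simp
    then have "J_le T u x"
      using J_le_restrict[OF ideal_r] u xy(2) ideal_mono[OF s] D_sub_ideal[of "Suc s" r] s by blast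
    then obtain a b where ab: "x \<in> carrier T" "a \<in> carrier T" "b \<in> carrier T" "tgt T a = src T x" "tgt T x = src T b"
      "u = a \<star>\<^bsub>T\<^esub> x \<star>\<^bsub>T\<^esub> b" unfolding J_le_def by blast
    note c = congD[OF \<tau> xy(1)]
    have "(a \<star>\<^bsub>T\<^esub> x, a \<star>\<^bsub>T\<^esub> y) \<in> \<tau>" using cong_mult_left[OF \<tau> xy(1) ab(2,4)] .
    then have "(u, a \<star>\<^bsub>T\<^esub> y \<star>\<^bsub>T\<^esub> b) \<in> \<tau>"
      using cong_mult_right[OF \<tau> _ ab(3), of "a \<star>\<^bsub>T\<^esub> x" "a \<star>\<^bsub>T\<^esub> y"] T.tgt_mult[OF ab(2,1,4)] ab by simp
    moreover have "a \<star>\<^bsub>T\<^esub> y \<in> ?A" "tgt T (a \<star>\<^bsub>T\<^esub> y) = src T b"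
      using ideal_in_T[OF s'] xy(3) ab c T.tgt_mult[of a y] by (simp_all add: is_ideal_def)
    then have "a \<star>\<^bsub>T\<^esub> y \<star>\<^bsub>T\<^esub> b \<in> ?A"
      using ideal_in_T[OF s'] ab by (simp add: is_ideal_def)
    ultimately show ?thesis by blast
  qed
  show ?thesis
  proof (rule subrelI)
    fix u v assume "(u, v) \<in> nabla (I (enat (Suc s)))"
    then have uv: "u \<in> ?B" "v \<in> ?B" "parallel U u v" by (auto simp: nabla_I)
    obtain u' v' where *: "u' \<in> ?A" "v' \<in> ?A" "(u, u') \<in> \<tau>" "(v, v') \<in> \<tau>" using ex uv by blast
    then have "parallel U u' v'"
      using uv(3) cong_parallel[OF \<tau> *(3)] cong_parallel[OF \<tau> *(4)] by (simp add: parallel_def)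
    then have "(u', v') \<in> \<tau>" using nab * by (auto simp: nabla_I)
    then show "(u, v) \<in> \<tau>" using * cong_trans[OF \<tau>] congD(5)[OF \<tau>] by blast
  qed
qed

text \<open>(S1) turns a pair joining \<open>D (s + 1)\<close> to the ideal below into one that
  satisfies the induction hypothesis at \<open>s\<close>; the resulting universality on
  \<open>I s\<close> climbs back up by \<open>nabla_step\<close>.\<close>

lemma nabla_of_non_H_pair:
  assumes \<tau>: "\<tau> \<in> Cong T" and "k \<le> s" "enat s \<le> r"
    and "(x, y) \<in> \<tau>" "x \<in> D s" "y \<in> ideal_up_to D (enat s)" "(x, y) \<notin> green_H U"
  shows "nabla (I (enat s)) \<subseteq> \<tau>"
  using assms(2-)
proof (induction s arbitrary: x y rule: dec_induct)
  case base
  have l: "level (enat k)" using level_s[OF k_le] .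
  have "y \<in> carrier (I (enat k)) - green_H (I (enat k)) `` {x}"
    using base by (auto simp: green_H_restrict[OF ideal[OF l]])
  moreover have "parallel (I (enat k)) x y"
    using cong_parallel[OF \<tau> base(2)] by (simp add: parallel_def)
  ultimately have "cong_gen (I (enat k)) {(x, y)} = nabla (I (enat k))"
    using gen base(3) unfolding nabla_gen_def by (simp add: max_J_class_I[OF l])
  then show ?case
    using cong_gen_sub[OF \<tau> k_le base(2)] base D_sub_ideal[of k "enat k"] by auto
next
  case (step s)
  let ?A = "ideal_up_to D (enat s)" and ?B = "ideal_up_to D (enat (Suc s))"
  have l: "level (enat (Suc s))" using level_s step.prems(1) by blast
  have sr: "enat s \<le> r" using step.prems(1) by (meson enat_ord_simps(1) le_SucI order_refl order_trans)
  \<comment> \<open>Stated for arbitrary pairs, because a pair inside \<open>D (s + 1)\<close> is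
    replaced through (S2) by a different pair that reaches the ideal.\<close>
  have below: "nabla (I (enat (Suc s))) \<subseteq> \<tau>"
    if xy: "(x, y) \<in> \<tau>" "x \<in> D (Suc s)" "y \<in> ?A" for x y
  proof -
    obtain x' y' where *: "(x', y') \<in> cong_gen (I (enat (Suc s))) {(x, y)}" "x' \<in> D s" "y' \<in> ?A" "(x', y') \<notin> green_H U"
      using S1[OF step.hyps(1) step.prems(1) xy(2,3) cong_parallel[OF \<tau> xy(1)]] by blast
    have "x \<in> ?B" "y \<in> ?B" using xy D_sub_ideal[of "Suc s" "enat (Suc s)"] ideal_mono[of "enat s" "enat (Suc s)"] by auto
    then have "(x', y') \<in> \<tau>" using * cong_gen_sub[OF \<tau> step.prems(1) xy(1)] by blast
    then have "nabla (I (enat s)) \<subseteq> \<tau>" using step.IH[OF sr _ *(2-4)] by blast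
    then show ?thesis using nabla_step[OF \<tau> step.prems(1) _ xy] by blast
  qed
  show ?case
  proof (cases "y \<in> ?A")
    case True
    then show ?thesis using below step.prems by blast
  next
    case False
    then have y: "y \<in> D (Suc s)" using step.prems(4) ideal_Suc[OF l] by blast
    obtain x' y' where *: "(x', y') \<in> cong_gen (I (enat (Suc s))) {(x, y)}" "x' \<in> D (Suc s)" "y' \<in> ?A"
      using S2[OF step.hyps(1) step.prems(1,3) y step.prems(5) cong_parallel[OF \<tau> step.prems(2)]] by blast
    have "x \<in> ?B" using step.prems(3) D_sub_ideal[of "Suc s" "enat (Suc s)"] by auto
    then have "(x', y') \<in> \<tau>" using * cong_gen_sub[OF \<tau> step.prems(1,2) _ step.prems(4)] by blast
    then show ?thesis using below * by blast
  qed
qed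

text \<open>The non-\<H> pair supplied by (S3) has its higher member in \<open>D s\<close>, which is
  why universality is reached one level below the given pair.\<close>

lemma nabla_of_non_zeta_pair:
  assumes \<tau>: "\<tau> \<in> Cong T" and s: "k \<le> s" "enat (Suc s) \<le> r"
    and xy: "(x, y) \<in> \<tau>" "x \<in> D (Suc s)" "(x, y) \<in> green_H U" "(x, y) \<notin> zeta U"
  shows "nabla (I (enat s)) \<subseteq> \<tau>"
proof -
  have sr: "enat s \<le> r" using s(2) by (meson enat_ord_simps(1) le_SucI order_refl order_trans)
  have y: "y \<in> D (Suc s)"
    using H_same_index[OF _ s(2) xy(2)] xy(1,3) congD(1,2)[OF \<tau> xy(1)] by (simp add: green_H_T)
  obtain x' y' where *: "(x', y') \<in> cong_gen (I (enat (Suc s))) {(x, y)}" "x' \<in> D s"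
    "y' \<in> ideal_up_to D (enat s)" "(x', y') \<notin> green_H U"
    using S3[OF s xy(2) y xy(3,4)] by blast
  have "(x', y') \<in> \<tau>"
    using * cong_gen_sub[OF \<tau> s(2) xy(1)] xy(2) y D_sub_ideal[of "Suc s" "enat (Suc s)"] by auto
  then show ?thesis using nabla_of_non_H_pair[OF \<tau> s(1) sr _ *(2-4)] by blast
qed

text \<open>The second member may lie in a higher class \<open>D t\<close>; in that case the
  reversed pair is used at level \<open>t\<close>. Either way a non-\<H> pair would make \<tau>
  universal on an ideal containing \<open>I m\<close>.\<close>

lemma H_above:
  assumes \<tau>: "\<tau> \<in> Cong T" and m: "k \<le> m" "enat m \<le> r" "\<not> nabla (I (enat m)) \<subseteq> \<tau>"
    and xy: "(x, y) \<in> \<tau>" and x: "x \<in> D s" "m \<le> s" "enat s \<le> r"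
  shows "(x, y) \<in> green_H U"
proof (rule ccontr)
  assume n: "(x, y) \<notin> green_H U"
  have no: "\<not> nabla (I (enat t)) \<subseteq> \<tau>" if "m \<le> t" for t
    using m(3) nabla_mono[of "enat m" "enat t"] that by auto
  obtain t where t: "enat t \<le> r" "y \<in> D t" using ideal_up_toE[OF level_r] congD(2)[OF \<tau> xy] by auto
  show False
  proof (cases "t \<le> s")
    case True
    then have "y \<in> ideal_up_to D (enat s)" using t(2) D_sub_ideal[of t "enat s"] by auto
    then show ?thesis using nabla_of_non_H_pair[OF \<tau> _ x(3) xy x(1) _ n] no[OF x(2)] m(1) x(2) by simp
  next
    case False
    then have "x \<in> ideal_up_to D (enat t)" using x(1) D_sub_ideal[of s "enat t"] by auto
    moreover have "(y, x) \<notin> green_H U" using n green_H_sym by blast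
    ultimately show ?thesis
      using nabla_of_non_H_pair[OF \<tau> _ t(1) congD(5)[OF \<tau> xy] t(2)] no[of t] m(1) x(2) False by simp
  qed
qed

text \<open>The inequality \<open>m < s\<close> is strict because a pair of \<open>D s\<close>
  outside \<zeta> forces universality on \<open>I (s - 1)\<close>, and this contradicts the
  assumption on \<open>m\<close> when \<open>m \<le> s - 1\<close>.\<close>

lemma zeta_above:
  assumes \<tau>: "\<tau> \<in> Cong T" and m: "k \<le> m" "enat m \<le> r" "\<not> nabla (I (enat m)) \<subseteq> \<tau>"
    and xy: "(x, y) \<in> \<tau>" and x: "x \<in> D s" "m < s" "enat s \<le> r"
  shows "(x, y) \<in> zeta T"
proof -
  obtain t where t: "s = Suc t" "m \<le> t" using x(2) by (cases s) auto
  have H: "(x, y) \<in> green_H U" using H_above[OF \<tau> m xy x(1)] x by simp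
  have "\<not> nabla (I (enat t)) \<subseteq> \<tau>"
    using m(3) nabla_mono[of "enat m" "enat t"] t(2) by auto
  then have "(x, y) \<in> zeta U"
    using nabla_of_non_zeta_pair[OF \<tau> _ _ xy _ H, of t] t m(1) x by auto
  then show ?thesis
    using congD(1,2)[OF \<tau> xy] by (simp add: zeta_restrict[OF ideal_r])
qed

section \<open>Assembling and decomposing the congruences on \<open>I r\<close>\<close>

lemma Int_zeta: "\<tau> \<in> Cong T \<Longrightarrow> \<tau> \<inter> zeta T \<in> Cong_H T"
  using Cong_Int T.zeta_Cong_H by (auto simp: Cong_H_def)

lemma index_cases:
  assumes "x \<in> carrier T"
  shows "x \<in> ideal_up_to D (enat m) \<or> (\<exists>s>m. enat s \<le> r \<and> x \<in> D s)"
proof -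
  obtain s where "enat s \<le> r" "x \<in> D s" using assms ideal_up_toE[OF level_r] by auto
  then show ?thesis using D_sub_ideal[of s "enat m"] by (cases "s \<le> m") (auto simp: not_le)
qed

text \<open>By liftability, a multiple of a \<sigma>-pair by an outside element is a \<sigma>-pair
  or a diagonal pair, and \<theta> contains the diagonal. For transitivity, \<theta> does not cross
  the boundary of \<open>I k\<close>, because \<H> lies in \<J>, and its pairs inside
  \<open>I k\<close> belong to \<sigma>.\<close>

lemma Cong_union:
  assumes \<sigma>: "\<sigma> \<in> Cong (I (enat k))" and \<theta>: "\<theta> \<in> Cong_H T"
    and sub: "\<theta> \<inter> carrier (I (enat k)) \<times> carrier (I (enat k)) \<subseteq> \<sigma>"
  shows "\<sigma> \<union> \<theta> \<in> Cong T"
proof -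
  let ?A = "ideal_up_to D (enat k)"
  have C: "\<theta> \<in> Cong T" "\<theta> \<subseteq> green_H T" using \<theta> by (auto simp: Cong_H_def)
  have L: "\<sigma> \<union> Id_on (carrier U) \<in> Cong U" using lift[OF \<sigma>] by (simp add: liftable_def)
  have A: "?A \<subseteq> carrier T" using ideal_mono[OF k_le] by simp
  have TU: "carrier T \<subseteq> carrier U" using ideal_r by (simp add: is_ideal_def)
  have \<sigma>A: "x \<in> ?A \<and> y \<in> ?A" if "(x, y) \<in> \<sigma>" for x y using congD(1,2)[OF \<sigma> that] by simp
  have \<theta>A: "y \<in> ?A \<longleftrightarrow> x \<in> ?A" if "(x, y) \<in> \<theta>" for x y
  proof -
    have "(x, y) \<in> green_J U" using that C(2) green_H_imp_J by (auto simp: green_H_T)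
    then show ?thesis using ideal_up_to_J_le[OF level_s[OF k_le]] by (auto simp: green_J_iff)
  qed
  have \<theta>\<sigma>: "(x, y) \<in> \<sigma>" if "(x, y) \<in> \<theta>" "x \<in> ?A" for x y
    using sub that \<theta>A[OF that(1)] by auto
  show ?thesis
  proof (rule CongI)
    fix x y assume xy: "(x, y) \<in> \<sigma> \<union> \<theta>"
    then show "x \<in> carrier T \<and> parallel T x y \<and> (y, x) \<in> \<sigma> \<union> \<theta>"
      using congD[OF \<sigma>, of x y] congD[OF C(1), of x y] A by (auto simp: parallel_def)
    fix s assume s: "s \<in> carrier T"
    { assume t: "tgt T x = src T s"
      show "(x \<star>\<^bsub>T\<^esub> s, y \<star>\<^bsub>T\<^esub> s) \<in> \<sigma> \<union> \<theta>"
      proof (cases "(x, y) \<in> \<theta>")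
        case True
        then show ?thesis using cong_mult_right[OF C(1) True s t] by simp
      next
        case False
        then have "(x \<star>\<^bsub>T\<^esub> s, y \<star>\<^bsub>T\<^esub> s) \<in> \<sigma> \<union> Id_on (carrier U)"
          using xy cong_mult_right[OF L, of x y s] s t TU by auto
        moreover have "x \<star>\<^bsub>T\<^esub> s \<in> carrier T"
          using T.mult_closed[of x s] s t False xy \<sigma>A A by auto
        ultimately show ?thesis using cong_refl[OF C(1)] by auto
      qed }
    { assume t: "tgt T s = src T x"
      show "(s \<star>\<^bsub>T\<^esub> x, s \<star>\<^bsub>T\<^esub> y) \<in> \<sigma> \<union> \<theta>"
      proof (cases "(x, y) \<in> \<theta>")
        case True
        then show ?thesis using cong_mult_left[OF C(1) True s t] by simp
      next
        case False
        then have "(s \<star>\<^bsub>T\<^esub> x, s \<star>\<^bsub>T\<^esub> y) \<in> \<sigma> \<union> Id_on (carrier U)"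
          using xy cong_mult_left[OF L, of x y s] s t TU by auto
        moreover have "s \<star>\<^bsub>T\<^esub> x \<in> carrier T"
          using T.mult_closed[of s x] s t False xy \<sigma>A A by auto
        ultimately show ?thesis using cong_refl[OF C(1)] by auto
      qed }
  next
    fix x y z assume "(x, y) \<in> \<sigma> \<union> \<theta>" "(y, z) \<in> \<sigma> \<union> \<theta>"
    then show "(x, z) \<in> \<sigma> \<union> \<theta>"
      using \<sigma>A \<theta>A \<theta>\<sigma> cong_trans[OF \<sigma>] cong_trans[OF C(1)] by blast
  qed (use cong_refl[OF C(1)] in blast)
qed

text \<open>This is the case \<open>m = k\<close>. The whole trace of \<tau> on \<open>I k\<close>
  serves as \<sigma>; any other pair has a member above \<open>D k\<close> and so lies in
  \<zeta>.\<close>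

lemma Cong_below_cases:
  assumes \<tau>: "\<tau> \<in> Cong T" and not: "\<not> nabla (I (enat k)) \<subseteq> \<tau>"
  shows "\<exists>\<sigma> \<theta>. \<tau> = \<sigma> \<union> \<theta> \<and> \<sigma> \<in> Cong (I (enat k)) \<and> \<theta> \<in> Cong_H T \<and>
    \<theta> \<inter> carrier (I (enat k)) \<times> carrier (I (enat k)) \<subseteq> \<sigma>"
proof -
  let ?A = "ideal_up_to D (enat k)"
  have "\<tau> \<inter> ?A \<times> ?A \<in> Cong (I (enat k))"
    using Cong_restrict[OF \<tau> ideal_in_T[OF k_le]] by simp
  moreover have "\<tau> = (\<tau> \<inter> ?A \<times> ?A) \<union> (\<tau> \<inter> zeta T)"
  proof -
    have "(x, y) \<in> (\<tau> \<inter> ?A \<times> ?A) \<union> (\<tau> \<inter> zeta T)" if xy: "(x, y) \<in> \<tau>" for x y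
    proof -
      note c = congD[OF \<tau> xy]
      have z: "(u, v) \<in> zeta T" if "(u, v) \<in> \<tau>" "k < s" "enat s \<le> r" "u \<in> D s" for u v s
        using zeta_above[OF \<tau> order_refl k_le not that(1,4,2,3)] .
      have zC: "zeta T \<in> Cong T" using T.zeta_Cong_H by (simp add: Cong_H_def)
      have "(x, y) \<in> zeta T" if "x \<notin> ?A \<or> y \<notin> ?A"
        using that index_cases[OF c(1), of k] index_cases[OF c(2), of k] z[OF xy] z[OF c(5)] congD(5)[OF zC] by blast
      then show ?thesis using xy by blast
    qed
    then show ?thesis by auto
  qed
  ultimately show ?thesis
    using Int_zeta[OF \<tau>] by (intro exI[of _ "\<tau> \<inter> ?A \<times> ?A"] exI[of _ "\<tau> \<inter> zeta T"]) auto
qed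

text \<open>This is the case \<open>m = q + 1\<close>. On \<open>D (Suc q)\<close> the congruence
  lies in \<H> but possibly not in \<zeta>, so there it enters through \<open>nu\<close> of its
  kernel group and not through \<tau> \<inter> \<zeta>.\<close>

lemma Cong_above_cases:
  assumes \<tau>: "\<tau> \<in> Cong T" and q: "k \<le> q" "enat q < r" and nab: "nabla (I (enat q)) \<subseteq> \<tau>"
    and not: "\<not> nabla (I (enat (Suc q))) \<subseteq> \<tau>"
  shows "\<tau> = rees_cong_nu T (carrier (I (enat q))) (D (Suc q)) (kernel_group \<tau> (Suc q)) \<union> (\<tau> \<inter> zeta T)"
proof -
  let ?A = "ideal_up_to D (enat q)" and ?\<nu> = "nu T (D (Suc q)) (kernel_group \<tau> (Suc q))"
  have q1: "enat (Suc q) \<le> r" using q by (simp add: Suc_ile_eq)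
  have k1: "k \<le> Suc q" using q by simp
  have l: "level (enat (Suc q))" using level_s[OF q1] .
  have H: "(x, y) \<in> green_H T" if "(x, y) \<in> \<tau>" "x \<in> D s" "Suc q \<le> s" "enat s \<le> r" for x y s
    using H_above[OF \<tau> k1 q1 not that(1,2,3,4)] congD(1,2)[OF \<tau> that(1)] by (simp add: green_H_T)
  have \<nu>: "\<tau> \<inter> D (Suc q) \<times> D (Suc q) = ?\<nu>"
    using cong_on_D[OF \<tau> q1] H q1 by blast
  have "(x, y) \<in> rees_cong_nu T (carrier (I (enat q))) (D (Suc q)) (kernel_group \<tau> (Suc q)) \<union> (\<tau> \<inter> zeta T)"
    if xy: "(x, y) \<in> \<tau>" for x y
  proof -
    note c = congD[OF \<tau> xy]
    have p: "parallel U x y" using cong_parallel[OF \<tau> xy] .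
    have upper: "(u, v) \<in> ?\<nu> \<or> (u, v) \<in> zeta T" if uv: "(u, v) \<in> \<tau>" "q < s" "enat s \<le> r" "u \<in> D s" for u v s
    proof (cases "s = Suc q")
      case True
      then have "v \<in> D (Suc q)" using H_same_index[OF H[OF uv(1,4) _ uv(3)] uv(3,4)] by simp
      then show ?thesis using \<nu> uv True by blast
    next
      case False
      then show ?thesis using zeta_above[OF \<tau> k1 q1 not uv(1,4) _ uv(3)] uv(2) by simp
    qed
    \<comment> \<open>\<open>upper\<close> looks at the first member of a pair; if only
      \<open>y\<close> is outside \<open>?A\<close>, it is applied to \<open>(y, x)\<close> and the
      result is turned around.\<close>
    have sym: "(x, y) \<in> ?\<nu> \<or> (x, y) \<in> zeta T" if "(y, x) \<in> ?\<nu> \<or> (y, x) \<in> zeta T"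
    proof -
      have "zeta T \<in> Cong T" using T.zeta_Cong_H by (simp add: Cong_H_def)
      then show ?thesis using that congD(5)[of "zeta T" T y x] \<nu> xy by blast
    qed
    have "(x, y) \<in> ?\<nu> \<or> (x, y) \<in> zeta T" if "x \<notin> ?A \<or> y \<notin> ?A"
      using that index_cases[OF c(1), of q] index_cases[OF c(2), of q] upper[OF xy] upper[OF c(5)] sym by blast
    then have "x \<in> ?A \<and> y \<in> ?A \<or> (x, y) \<in> ?\<nu> \<or> (x, y) \<in> zeta T" by blast
    then show ?thesis
      using xy p by (auto simp: rees_cong_nu_def rees_cong_def nabla_def parallel_def)
  qed
  moreover have "rees_cong_nu T (carrier (I (enat q))) (D (Suc q)) (kernel_group \<tau> (Suc q)) \<subseteq> \<tau>"
    using nab \<nu> cong_refl[OF \<tau>] by (auto simp: rees_cong_nu_def rees_cong_def)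
  ultimately show ?thesis by auto
qed

lemma Cong_eq:
  "Cong T =
     {\<sigma> \<union> \<theta> | \<sigma> \<theta>. \<sigma> \<in> Cong (I (enat k)) \<and> \<theta> \<in> Cong_H T \<and>
        \<theta> \<inter> carrier (I (enat k)) \<times> carrier (I (enat k)) \<subseteq> \<sigma>} \<union>
     {rees_cong_nu T (carrier (I (enat q))) (D (q + 1)) N \<union> \<theta> | q N \<theta>.
        k \<le> q \<and> enat q < r \<and> N \<lhd> H_group U (G (q + 1)) \<and>
        \<theta> \<in> Cong_H T \<and> NZ_of T r D G \<theta> (q + 1) \<subseteq> N} \<union>
     {nabla T}" (is "_ = ?X \<union> ?Y \<union> _")
proof (intro equalityI subsetI)
  have NZ: "NZ_of T r D G \<theta> (q + 1) = kernel_group \<theta> (Suc q)" if "\<theta> \<in> Cong_H T" "enat q < r" for \<theta> q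
    using NZ_of_eq[OF that(1)] that(2) by (simp add: Suc_ile_eq)
  {
    fix \<tau> assume "\<tau> \<in> ?X \<union> ?Y \<union> {nabla T}"
    then show "\<tau> \<in> Cong T"
    proof (elim UnE)
      assume "\<tau> \<in> ?X"
      then show ?thesis by (elim CollectE exE conjE) (simp add: Cong_union)
    next
      assume "\<tau> \<in> ?Y"
      then obtain q N \<theta> where "\<tau> = rees_cong_nu T (carrier (I (enat q))) (D (q + 1)) N \<union> \<theta>"
        "enat q < r" "N \<lhd> H_group U (G (q + 1))" "\<theta> \<in> Cong_H T" "NZ_of T r D G \<theta> (q + 1) \<subseteq> N"
        by (elim CollectE exE conjE) (rule that)
      then show ?thesis using rees_cong_nu_union_Cong[of q N \<theta>] NZ[of \<theta> q] by simp
    next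
      assume "\<tau> \<in> {nabla T}"
      then show ?thesis using T.nabla_Cong by simp
    qed
  }
  fix \<tau> assume \<tau>: "\<tau> \<in> Cong T"
  show "\<tau> \<in> ?X \<union> ?Y \<union> {nabla T}"
  proof (cases "\<exists>m \<ge> k. enat m \<le> r \<and> \<not> nabla (I (enat m)) \<subseteq> \<tau>")
    case False
    have "nabla T \<subseteq> \<tau>"
    proof (rule subrelI)
      fix x y assume xy: "(x, y) \<in> nabla T"
      then have "x \<in> ideal_up_to D r" "y \<in> ideal_up_to D r" by (auto simp: nabla_def)
      then obtain p q where pq: "enat p \<le> r" "x \<in> D p" "enat q \<le> r" "y \<in> D q"
        using ideal_up_toE[OF level_r] by metis
      \<comment> \<open>Any two elements lie in a common \<open>I m\<close> with
        \<open>k \<le> m\<close>, so universality on all these ideals gives universality on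
        \<open>T\<close>, also for \<open>r = \<infinity>\<close>, where there is no top
        class.\<close>
      define m where "m = max k (max p q)"
      have "enat m \<le> r" using pq k_le by (simp add: m_def max_def)
      moreover have "x \<in> ideal_up_to D (enat m)" "y \<in> ideal_up_to D (enat m)"
        using pq D_sub_ideal[of p "enat m"] D_sub_ideal[of q "enat m"]
        by (auto simp: m_def le_max_iff_disj)
      ultimately have "(x, y) \<in> nabla (I (enat m))" "enat m \<le> r" "k \<le> m"
        using xy by (simp_all add: nabla_I m_def)
      then show "(x, y) \<in> \<tau>" using False by blast
    qed
    moreover have "\<tau> \<subseteq> nabla T"
      using congD(1-4)[OF \<tau>] by (auto simp: nabla_def parallel_def)
    ultimately have "\<tau> = nabla T" by (rule equalityI[rotated])
    then show ?thesis by (intro UnI2) simp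
  next
    case True
    \<comment> \<open>If \<open>m > k\<close>, minimality supplies universality on
      \<open>I (m - 1)\<close>, the ideal of the Rees part in the second family.\<close>
    define m where "m = (LEAST m. k \<le> m \<and> enat m \<le> r \<and> \<not> nabla (I (enat m)) \<subseteq> \<tau>)"
    have m: "k \<le> m" "enat m \<le> r" "\<not> nabla (I (enat m)) \<subseteq> \<tau>"
      using LeastI_ex[OF True] unfolding m_def by auto
    show ?thesis
    proof (cases "m = k")
      case True
      then have "\<tau> \<in> ?X" using Cong_below_cases[OF \<tau>] m(3) by simp
      then show ?thesis by (intro UnI1)
    next
      case False
      then obtain q where q: "m = Suc q" "k \<le> q" using m(1) by (cases m) auto
      have qr: "enat q < r" using m(2) q(1) by (simp add: Suc_ile_eq)
      have "nabla (I (enat q)) \<subseteq> \<tau>"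
        using not_less_Least[of q "\<lambda>m. k \<le> m \<and> enat m \<le> r \<and> \<not> nabla (I (enat m)) \<subseteq> \<tau>"] q qr
        unfolding m_def[symmetric] by auto
      then have eq: "\<tau> = rees_cong_nu T (carrier (I (enat q))) (D (q + 1)) (kernel_group \<tau> (q + 1)) \<union> (\<tau> \<inter> zeta T)"
        using Cong_above_cases[OF \<tau> q(2) qr] m(3) q(1) by simp
      have normal: "kernel_group \<tau> (q + 1) \<lhd> H_group U (G (q + 1))"
        using kernel_group_normal[OF \<tau>] m(2) q(1) by simp
      have "NZ_of T r D G (\<tau> \<inter> zeta T) (q + 1) \<subseteq> kernel_group \<tau> (q + 1)"
        unfolding NZ[OF Int_zeta[OF \<tau>] qr] by (auto simp: kernel_group_def)
      then have "\<tau> \<in> ?Y"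
        by (intro CollectI exI conjI) (rule eq q(2) qr normal Int_zeta[OF \<tau>] | assumption)+
      then show ?thesis by (intro UnI1 UnI2)
    qed
  qed
qed

end

theorem theorem10p8:
  fixes U :: "('a, 'c) partial_semigroup"
    and \<xi> r :: enat and k :: nat
    and D G :: "nat \<Rightarrow> 'a set"
    and I :: "enat \<Rightarrow> ('a, 'c) partial_semigroup"
  defines "I \<equiv> (\<lambda>s. restrict_to U (ideal_up_to D s))"
  assumes chain: "chain_of_ideals U \<xi> D"
    and group_classes: "\<And>q. enat q < \<xi> \<Longrightarrow> group_H_class U (G q) \<and> G q \<subseteq> D q"
    and k: "enat k < \<xi>"
    and lift: "\<And>\<sigma>. \<sigma> \<in> Cong (I k) \<Longrightarrow> liftable U \<sigma>"
    and gen: "nabla_gen (I k)"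
    and sep: "\<And>s. k < s \<Longrightarrow> enat s < \<xi> \<Longrightarrow> Sep_zeta (I s)"
    and r: "enat k \<le> r" "r < \<xi> \<or> (r = \<infinity> \<and> \<xi> = \<infinity>)"
  shows "Cong_H (I r) = {Theta (I r) r D N | N. NZ_tuple (I r) r D G N} \<and>
         Cong (I r) =
           {\<sigma> \<union> \<theta> | \<sigma> \<theta>. \<sigma> \<in> Cong (I k) \<and> \<theta> \<in> Cong_H (I r) \<and>
                        \<theta> \<inter> carrier (I k) \<times> carrier (I k) \<subseteq> \<sigma>} \<union>
           {rees_cong_nu (I r) (carrier (I q)) (D (q + 1)) N \<union> \<theta> | q N \<theta>.
              k \<le> q \<and> enat q < r \<and> N \<lhd> H_group U (G (q + 1)) \<and>
              \<theta> \<in> Cong_H (I r) \<and> NZ_of (I r) r D G \<theta> (q + 1) \<subseteq> N} \<union>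
           {nabla (I r)}"
proof -
  interpret ideal_chain U \<xi> D by unfold_locales (rule chain)
  interpret separated_chain U \<xi> D G r k
  proof
    show "level r" unfolding level_def using r(2) by auto
    fix q \<sigma> s
    show "enat q < \<xi> \<Longrightarrow> group_H_class U (G q) \<and> G q \<subseteq> D q" by (rule group_classes)
    show "\<sigma> \<in> Cong (restrict_to U (ideal_up_to D (enat k))) \<Longrightarrow> liftable U \<sigma>"
      using lift by (simp add: I_def)
    show "k < s \<Longrightarrow> enat s < \<xi> \<Longrightarrow> Sep_zeta (restrict_to U (ideal_up_to D (enat s)))"
      using sep by (simp add: I_def)
    show "nabla_gen (restrict_to U (ideal_up_to D (enat k)))" using gen by (simp add: I_def)
  qed (rule r(1))
  show ?thesis unfolding I_def using Cong_H_eq Cong_eq by (rule conjI)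
qed

end
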